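(* The parameterized problem Stable Cutset[mod cluster] admits a polynomial kernelization to equivalent instances with $\mathcal{O}(|X|^5)$ vertices. That is, there is an algorithm running in time polynomial in the input size which, given a graph $G$ and a set $X\subseteq V(G)$ such that $G-X$ is a cluster graph, outputs a graph $G'$ and a set $X'\subseteq V(G')$ such that $G'-X'$ is a cluster graph, $G'$ has a stable cutset if and only if $G$ has a stable cutset, and $|V(G')|\le c\cdot|X|^5$ for some absolute constant $c$.
   Context: All graphs are finite and simple. A stable cutset of a graph $G$ is a set $S\subseteq V(G)$ whose vertices are pairwise non-adjacent and such that $G-S$ is disconnected (has at least two connected components); the empty set is a stable cutset of any disconnected graph. A cluster graph is a disjoint union of cliques (a graph each of whose connected components is a complete graph). Stable Cutset[mod cluster]: input is a graph $G$ and $X\subseteq V(G)$ with $G-X$ a cluster graph; the parameter is $|X|$; the question is whether $G$ has a stable cutset. A kernelization may alternatively output a constant-size yes- or no-instance.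
   Formalization: For empty X the bound c·|X|^5 would force an empty G', which is impossible when G is, e.g., two isolated vertices; the formal bound is c·max(1,|X|)^5, i.e. a constant-size instance when X is empty and the stated bound otherwise. *)

theory Defs
  imports
    "Graph_Theory.Graph_Theory"
    "HOL-Computational_Algebra.Polynomial"
begin

section \<open>Stable cutsets and cluster graphs\<close>

text \<open>
  Finite simple graphs are the finite, symmetric, loop-free digraphs without parallel arcs of
  \<^theory>\<open>Graph_Theory.Digraph\<close>. As arcs come in symmetric pairs, the strongly connected
  components (\<^const>\<open>pre_digraph.sccs\<close>) are exactly the connected components; each of them is
  nonempty, so the null graph has none and is not disconnected.
\<close>

definition delete_verts :: "('a, 'b) pre_digraph \<Rightarrow> 'a set \<Rightarrow> ('a, 'b) pre_digraph" where
  "delete_verts G S = G \<restriction> (verts G - S)"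

definition disconnected_graph :: "('a, 'b) pre_digraph \<Rightarrow> bool" where
  "disconnected_graph G \<longleftrightarrow> card (pre_digraph.sccs G) \<ge> 2"

definition stable_cutset :: "('a, 'b) pre_digraph \<Rightarrow> 'a set \<Rightarrow> bool" where
  "stable_cutset G S \<longleftrightarrow>
     S \<subseteq> verts G \<and> (\<forall>u\<in>S. \<forall>v\<in>S. (u, v) \<notin> arcs_ends G) \<and> disconnected_graph (delete_verts G S)"

definition has_stable_cutset :: "('a, 'b) pre_digraph \<Rightarrow> bool" where
  "has_stable_cutset G \<longleftrightarrow> (\<exists>S. stable_cutset G S)"

definition cluster_graph :: "('a, 'b) pre_digraph \<Rightarrow> bool" where
  "cluster_graph G \<longleftrightarrow> graph G \<and> (\<forall>H \<in> pre_digraph.sccs G. complete_digraph (card (verts H)) H)"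

definition mod_cluster_instance :: "'a pair_pre_digraph \<Rightarrow> 'a set \<Rightarrow> bool" where
  "mod_cluster_instance G X \<longleftrightarrow>
     pair_graph G \<and> X \<subseteq> pverts G \<and> cluster_graph (delete_verts (with_proj G) X)"


section \<open>A model of computation\<close>

text \<open>
  The WHILE language of N. D. Jones (\<^emph>\<open>Computability and Complexity from a Programming
  Perspective\<close>): imperative programs whose variables hold binary trees. Every operation is charged
  the size of the tree it produces (an equality test additionally the sizes of the compared trees,
  through its operands) rather than one unit, so that sharing cannot build exponentially large
  trees in polynomial time. With this cost measure, WHILE programs and Turing machines simulate
  each other with polynomial overhead.
\<close>

datatype data = Nil_d | Cons_d data data

primrec dsize :: "data \<Rightarrow> nat" where
  "dsize Nil_d = 1"
| "dsize (Cons_d a b) = 1 + dsize a + dsize b"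

primrec hd_d :: "data \<Rightarrow> data" where
  "hd_d Nil_d = Nil_d"
| "hd_d (Cons_d a b) = a"

primrec tl_d :: "data \<Rightarrow> data" where
  "tl_d Nil_d = Nil_d"
| "tl_d (Cons_d a b) = b"

primrec list_d :: "data list \<Rightarrow> data" where
  "list_d [] = Nil_d"
| "list_d (x # xs) = Cons_d x (list_d xs)"

definition bool_d :: "bool \<Rightarrow> data" where
  "bool_d b = (if b then Cons_d Nil_d Nil_d else Nil_d)"

type_synonym store = "nat \<Rightarrow> data"

datatype expr =
    Var nat
  | Const data
  | Cons_e expr expr
  | Hd_e expr
  | Tl_e expr
  | Eq_e expr expr

primrec eval_e :: "expr \<Rightarrow> store \<Rightarrow> data" where
  "eval_e (Var x) s = s x"
| "eval_e (Const d) s = d"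
| "eval_e (Cons_e e f) s = Cons_d (eval_e e s) (eval_e f s)"
| "eval_e (Hd_e e) s = hd_d (eval_e e s)"
| "eval_e (Tl_e e) s = tl_d (eval_e e s)"
| "eval_e (Eq_e e f) s = bool_d (eval_e e s = eval_e f s)"

primrec cost_e :: "expr \<Rightarrow> store \<Rightarrow> nat" where
  "cost_e (Var x) s = dsize (s x)"
| "cost_e (Const d) s = dsize d"
| "cost_e (Cons_e e f) s = cost_e e s + cost_e f s + dsize (eval_e (Cons_e e f) s)"
| "cost_e (Hd_e e) s = cost_e e s + dsize (eval_e (Hd_e e) s)"
| "cost_e (Tl_e e) s = cost_e e s + dsize (eval_e (Tl_e e) s)"
| "cost_e (Eq_e e f) s = cost_e e s + cost_e f s + dsize (eval_e (Eq_e e f) s)"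

datatype com =
    Assign nat expr
  | Seq com com
  | Cond expr com com
  | While expr com

text \<open>
  \<open>exec c s t s'\<close>: started in store \<open>s\<close>, the command \<open>c\<close> halts in store \<open>s'\<close> after time \<open>t\<close>.
  A test succeeds iff its value is not \<^const>\<open>Nil_d\<close>.
\<close>

inductive exec :: "com \<Rightarrow> store \<Rightarrow> nat \<Rightarrow> store \<Rightarrow> bool" where
  Assign: "exec (Assign x e) s (1 + cost_e e s) (s(x := eval_e e s))"
| Seq: "exec c s t s' \<Longrightarrow> exec d s' t' s'' \<Longrightarrow> exec (Seq c d) s (t + t') s''"
| CondTrue: "eval_e e s \<noteq> Nil_d \<Longrightarrow> exec c s t s' \<Longrightarrow> exec (Cond e c d) s (1 + cost_e e s + t) s'"
| CondFalse: "eval_e e s = Nil_d \<Longrightarrow> exec d s t s' \<Longrightarrow> exec (Cond e c d) s (1 + cost_e e s + t) s'"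
| WhileFalse: "eval_e e s = Nil_d \<Longrightarrow> exec (While e c) s (1 + cost_e e s) s"
| WhileTrue: "eval_e e s \<noteq> Nil_d \<Longrightarrow> exec c s t s' \<Longrightarrow> exec (While e c) s' t' s'' \<Longrightarrow>
    exec (While e c) s (1 + cost_e e s + t + t') s''"

inductive_cases AssignE: "exec (Assign x e) s t s'"
inductive_cases SeqE: "exec (Seq c d) s t s'"
inductive_cases CondE: "exec (Cond e c d) s t s'"
inductive_cases WhileE: "exec (While e c) s t s'"

lemma exec_deterministic: "exec c s t s' \<Longrightarrow> exec c s u s'' \<Longrightarrow> u = t \<and> s'' = s'"
proof (induction arbitrary: u s'' rule: exec.induct)
  case (Assign x e s)
  from Assign.prems show ?case by (rule AssignE) simp
next
  case (Seq c s t s' d t' s1)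
  from Seq.prems show ?case
    by (rule SeqE) (metis Seq.IH)
next
  case (CondTrue e s c t s' d)
  from CondTrue.prems show ?case
    by (rule CondE) (use CondTrue.IH CondTrue.hyps(1) in auto)
next
  case (CondFalse e s d t s' c)
  from CondFalse.prems show ?case
    by (rule CondE) (use CondFalse.IH CondFalse.hyps(1) in auto)
next
  case (WhileFalse e s c)
  from WhileFalse.prems show ?case
    by (rule WhileE) (use WhileFalse.hyps in auto)
next
  case (WhileTrue e s c t s' t' s1)
  from WhileTrue.prems show ?case
    by (rule WhileE) (use WhileTrue.hyps(1) in simp, use WhileTrue.IH in fastforce)
qed

text \<open>Input and output are passed in variable \<open>0\<close>; all other variables are initially \<^const>\<open>Nil_d\<close>.\<close>

definition computes :: "com \<Rightarrow> data \<Rightarrow> data \<Rightarrow> nat \<Rightarrow> bool" where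
  "computes P x y t \<longleftrightarrow> (\<exists>s. exec P ((\<lambda>_. Nil_d)(0 := x)) t s \<and> s 0 = y)"

text \<open>
  A graph with vertex set \<open>{v\<^sub>1 < \<dots> < v\<^sub>n}\<close> together with a vertex set \<open>X\<close> is
  represented by the list whose \<open>i\<close>-th entry is the pair of the bit \<open>v\<^sub>i \<in> X\<close> and the
  \<open>i\<close>-th row of the adjacency matrix. The size of this tree is quadratic in \<open>n\<close>.
\<close>

definition encode_instance :: "nat pair_pre_digraph \<Rightarrow> nat set \<Rightarrow> data" where
  "encode_instance G X =
     (let vs = sorted_list_of_set (pverts G)
      in list_d (map (\<lambda>v. Cons_d (bool_d (v \<in> X))
                                 (list_d (map (\<lambda>w. bool_d ((v, w) \<in> parcs G)) vs))) vs))"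

end

theory Submission
  imports Defs
begin

text \<open>
  A stable cutset amounts to disjoint nonempty vertex sets \<open>A\<close>, \<open>B\<close> without edges between them whose
  complement \<open>S\<close> is stable. Each clique \<open>K\<close> of \<open>G - X\<close> has at most one vertex in \<open>S\<close>, and the others all lie
  on one side. If \<open>B\<close> avoids \<open>X\<close>, then the neighbourhood of \<open>K\<close> or of some \<open>K - {w}\<close> is stable; this
  is tested directly. Otherwise both sides meet \<open>X\<close>, and it only matters which colourings of \<open>X\<close> by
  \<open>A\<close>, \<open>B\<close>, \<open>S\<close> extend to all cliques.

  A colouring of \<open>X\<close> does not extend to \<open>K\<close> iff \<open>K\<close> is forced to both sides. It is forced to \<open>B\<close> iff two
  distinct vertices of \<open>K\<close> have neighbours in \<open>B\<close>, or a single vertex has neighbours in \<open>B\<close> and in \<open>S\<close>;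
  similarly for \<open>A\<close>. Such an obstruction involves at most four vertices of \<open>X\<close>, so it suffices to keep, for each
  quadruple of \<open>X\<close> and each of the four kinds of obstruction, one clique exhibiting it. Of this clique one keeps
  \<open>O(|X|)\<close> vertices: witnesses of the obstruction, and two neighbours of each \<open>x \<in> X\<close>, which ensure that no
  \<open>K - {w}\<close> acquires a stable neighbourhood.
\<close>

section \<open>Polynomial-time WHILE programs\<close>

lemma poly_nat_mono: "m \<le> n \<Longrightarrow> poly (p :: nat poly) m \<le> poly p n"
  by (induction p) (auto intro!: mult_mono add_mono)

section \<open>Trees, their sizes, and lists coded as trees\<close>

lemma dsize_pos [simp]: "0 < dsize d"
  by (cases d) auto

lemma dsize_hd_d: "dsize (hd_d d) \<le> dsize d"
  by (cases d) auto

lemma dsize_tl_d: "dsize (tl_d d) \<le> dsize d"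
  by (cases d) auto

text \<open>Every tree is a right spine of \<open>Cons_d\<close> cells ending in
  \<open>Nil_d\<close>, so \<open>list_d\<close> is a bijection onto \<open>data\<close> and this is
  its inverse. List functions can therefore be treated on all trees, without a well-formedness
  condition.\<close>

primrec dlist :: "data \<Rightarrow> data list" where
  "dlist Nil_d = []"
| "dlist (Cons_d a b) = a # dlist b"

lemma list_d_dlist [simp]: "list_d (dlist d) = d"
  by (induction d) auto

lemma dlist_list_d [simp]: "dlist (list_d xs) = xs"
  by (induction xs) auto

lemma dsize_list_d: "dsize (list_d xs) = 1 + (\<Sum>x\<leftarrow>xs. 1 + dsize x)"
  by (induction xs) auto

lemma dsize_list_d_append: "dsize (list_d (xs @ ys)) + 1 = dsize (list_d xs) + dsize (list_d ys)"
  by (induction xs) auto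

lemma length_le_dsize: "length xs \<le> dsize (list_d xs)"
  by (induction xs) auto

lemma dsize_member: "x \<in> set xs \<Longrightarrow> dsize x < dsize (list_d xs)"
  by (induction xs) auto

lemma list_d_eq_Nil [simp]: "list_d xs = Nil_d \<longleftrightarrow> xs = []"
  by (cases xs) auto

lemma bool_d_eq_Nil [simp]: "bool_d b = Nil_d \<longleftrightarrow> \<not> b"
  by (simp add: bool_d_def)

lemma hd_d_list_d: "hd_d (list_d xs) = (if xs = [] then Nil_d else hd xs)"
  by (cases xs) auto

lemma tl_d_list_d: "tl_d (list_d xs) = list_d (tl xs)"
  by (cases xs) auto

text \<open>
  The program may overwrite any variable from \<open>r\<close> on and assumes nothing about the initial values of
  the variables beyond \<open>r\<close>; quantifying over \<open>r\<close> makes such programs composable without renaming.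
\<close>

definition runs_in :: "(nat \<Rightarrow> com) \<Rightarrow> (data \<Rightarrow> data) \<Rightarrow> nat poly \<Rightarrow> bool" where
  "runs_in C f p \<longleftrightarrow> (\<forall>r s. \<exists>t s'. exec (C r) s t s' \<and> s' r = f (s r) \<and>
     (\<forall>i<r. s' i = s i) \<and> t + dsize (f (s r)) \<le> poly p (dsize (s r)))"

definition polytime :: "(data \<Rightarrow> data) \<Rightarrow> bool" where
  "polytime f \<longleftrightarrow> (\<exists>C p. runs_in C f p)"

lemma runs_inD:
  assumes "runs_in C f p"
  shows "\<exists>t s'. exec (C r) s t s' \<and> s' r = f (s r) \<and>
    (\<forall>i<r. s' i = s i) \<and> t + dsize (f (s r)) \<le> poly p (dsize (s r))"
  using assms unfolding runs_in_def by simp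

lemma polytimeI:
  assumes "\<And>r s. \<exists>t s'. exec (C r) s t s' \<and> s' r = f (s r) \<and>
     (\<forall>i<r. s' i = s i) \<and> t + dsize (f (s r)) \<le> poly p (dsize (s r))"
  shows "polytime f"
  using assms unfolding polytime_def runs_in_def by blast

lemma polytimeE:
  assumes "polytime f"
  obtains C p where "runs_in C f p"
  using assms unfolding polytime_def by blast

text \<open>\<open>runs_in\<close> charges the output size to the same polynomial as the running
  time. The bounds on loop accumulators below are obtained from this.\<close>

lemma polytime_size:
  assumes "polytime f"
  obtains p :: "nat poly" where "\<And>x. dsize (f x) \<le> poly p (dsize x)"
proof -
  obtain C p where C: "runs_in C f p"
    using assms by (rule polytimeE)
  have "dsize (f x) \<le> poly p (dsize x)" for x
    using runs_inD[OF C, of 0 "\<lambda>_. x"] by auto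
  then show ?thesis using that by blast
qed

section \<open>Assignment, composition, conditional and loop\<close>

lemma polytime_expr:
  fixes p :: "nat poly"
  assumes "\<And>r s. eval_e (e r) s = f (s r)"
    and "\<And>r s. 1 + cost_e (e r) s + dsize (f (s r)) \<le> poly p (dsize (s r))"
  shows "polytime f"
proof (rule polytimeI[where p = p and C = "\<lambda>r. Assign r (e r)"])
  fix r s
  have "exec (Assign r (e r)) s (1 + cost_e (e r) s) (s(r := f (s r)))"
    using exec.Assign[of r "e r" s] assms(1) by simp
  then show "\<exists>t s'. exec (Assign r (e r)) s t s' \<and> s' r = f (s r) \<and> (\<forall>i<r. s' i = s i) \<and>
      t + dsize (f (s r)) \<le> poly p (dsize (s r))"
    using assms(2)[of r s] by (intro exI[of _ "1 + cost_e (e r) s"] exI[of _ "s(r := f (s r))"]) simp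
qed

lemma polytime_id: "polytime (\<lambda>x. x)"
  by (rule polytime_expr[where e = Var and p = "[:1, 2:]"]) auto

lemma polytime_const: "polytime (\<lambda>_. d)"
  by (rule polytime_expr[where e = "\<lambda>_. Const d" and p = "[:1 + 2 * dsize d:]"]) auto

lemma polytime_comp:
  assumes "polytime g" "polytime f"
  shows "polytime (\<lambda>x. g (f x))"
proof -
  from assms(1) obtain C p where C: "runs_in C g p" by (rule polytimeE)
  from assms(2) obtain D q where D: "runs_in D f q" by (rule polytimeE)
  show ?thesis
  proof (rule polytimeI[where p = "q + pcompose p q" and C = "\<lambda>r. Seq (D r) (C r)"])
    fix r s
    show "\<exists>t s'. exec (Seq (D r) (C r)) s t s' \<and> s' r = g (f (s r)) \<and> (\<forall>i<r. s' i = s i) \<and>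
      t + dsize (g (f (s r))) \<le> poly (q + pcompose p q) (dsize (s r))"
    proof -
      obtain t s' where 1: "exec (D r) s t s'" "s' r = f (s r)" "\<forall>i<r. s' i = s i"
        "t + dsize (f (s r)) \<le> poly q (dsize (s r))" using runs_inD[OF D] by blast
      obtain t' s'' where 2: "exec (C r) s' t' s''" "s'' r = g (s' r)" "\<forall>i<r. s'' i = s' i"
        "t' + dsize (g (s' r)) \<le> poly p (dsize (s' r))" using runs_inD[OF C] by blast
      have "poly p (dsize (s' r)) \<le> poly p (poly q (dsize (s r)))"
        using 1 by (intro poly_nat_mono) auto
      then show ?thesis
        using 1 2 by (intro exI[of _ "t + t'"] exI[of _ s''] conjI exec.Seq) (auto simp: poly_pcompose)
    qed
  qed
qed

lemma polytime_hd: "polytime f \<Longrightarrow> polytime (\<lambda>x. hd_d (f x))"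
proof (rule polytime_comp[where g = hd_d])
  show "polytime hd_d"
  proof (rule polytime_expr[where e = "\<lambda>r. Hd_e (Var r)" and p = "[:1, 3:]"])
    show "1 + cost_e (Hd_e (Var r)) s + dsize (hd_d (s r)) \<le> poly [:1, 3:] (dsize (s r))" for r s
      using dsize_hd_d[of "s r"] by simp
  qed simp
qed

lemma polytime_tl: "polytime f \<Longrightarrow> polytime (\<lambda>x. tl_d (f x))"
proof (rule polytime_comp[where g = tl_d])
  show "polytime tl_d"
  proof (rule polytime_expr[where e = "\<lambda>r. Tl_e (Var r)" and p = "[:1, 3:]"])
    show "1 + cost_e (Tl_e (Var r)) s + dsize (tl_d (s r)) \<le> poly [:1, 3:] (dsize (s r))" for r s
      using dsize_tl_d[of "s r"] by simp
  qed simp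
qed

text \<open>Serves both pairing and the equality test. The input in \<open>r\<close> and the value
  of \<open>f\<close> in \<open>Suc r\<close> survive because a program started at a register leaves
  all lower registers unchanged.\<close>

lemma polytime_binop:
  fixes q :: "nat poly"
  assumes "polytime f" "polytime g"
    and eval: "\<And>i j s. eval_e (e i j) s = h (s i) (s j)"
    and cost: "\<And>i j s. cost_e (e i j) s + dsize (h (s i) (s j)) \<le> poly q (dsize (s i) + dsize (s j))"
  shows "polytime (\<lambda>x. h (f x) (g x))"
proof -
  from assms(1) obtain C p1 where C: "runs_in C f p1" by (rule polytimeE)
  from assms(2) obtain D p2 where D: "runs_in D g p2" by (rule polytimeE)
  let ?p = "[:3, 2:] + p1 + p2 + pcompose q (p1 + p2)"
  let ?c = "\<lambda>r. Seq (Assign (Suc r) (Var r)) (Seq (C (Suc r)) (Seq (Assign (r + 2) (Var r))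
        (Seq (D (r + 2)) (Assign r (e (Suc r) (r + 2))))))"
  show ?thesis
  proof (rule polytimeI[where p = ?p and C = ?c])
    fix r s
    show "\<exists>t s'. exec (?c r) s t s' \<and> s' r = h (f (s r)) (g (s r)) \<and> (\<forall>i<r. s' i = s i) \<and>
      t + dsize (h (f (s r)) (g (s r))) \<le> poly ?p (dsize (s r))"
    proof -
      define s1 where "s1 = s(Suc r := s r)"
      have 1: "exec (Assign (Suc r) (Var r)) s (1 + dsize (s r)) s1"
        using exec.Assign[of "Suc r" "Var r" s] by (simp add: s1_def)
      obtain t2 s2 where 2: "exec (C (Suc r)) s1 t2 s2" "s2 (Suc r) = f (s r)" "\<forall>i\<le>r. s2 i = s i"
        "t2 + dsize (f (s r)) \<le> poly p1 (dsize (s r))" using runs_inD[OF C, of "Suc r" s1] by (auto simp: s1_def)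
      define s3 where "s3 = s2(r + 2 := s r)"
      have 3: "exec (Assign (r + 2) (Var r)) s2 (1 + dsize (s r)) s3"
        using exec.Assign[of "r + 2" "Var r" s2] 2 by (simp add: s3_def)
      obtain t4 s4 where 4: "exec (D (r + 2)) s3 t4 s4" "s4 (r + 2) = g (s r)" "\<forall>i\<le>Suc r. s4 i = s3 i"
        "t4 + dsize (g (s r)) \<le> poly p2 (dsize (s r))" using runs_inD[OF D, of "r + 2" s3] by (auto simp: s3_def less_Suc_eq_le)
      define s5 where "s5 = s4(r := h (f (s r)) (g (s r)))"
      define t5 where "t5 = cost_e (e (Suc r) (r + 2)) s4"
      have s4: "s4 (Suc r) = f (s r)" using 2 4 by (simp add: s3_def)
      have 5: "exec (Assign r (e (Suc r) (r + 2))) s4 (1 + t5) s5"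
        using exec.Assign[of r "e (Suc r) (r + 2)" s4] eval 4(2) s4 by (simp add: s5_def t5_def)
      have "t5 + dsize (h (f (s r)) (g (s r))) \<le> poly q (dsize (f (s r)) + dsize (g (s r)))"
        using cost[of "Suc r" "r + 2" s4] s4 4(2) by (simp add: t5_def)
      also have "\<dots> \<le> poly q (poly (p1 + p2) (dsize (s r)))"
        using 2 4 by (intro poly_nat_mono) auto
      finally have "(1 + dsize (s r)) + (t2 + ((1 + dsize (s r)) + (t4 + (1 + t5)))) +
          dsize (h (f (s r)) (g (s r))) \<le> poly ?p (dsize (s r))"
        using 2(4) 4(4) by (simp add: poly_pcompose)
      moreover have "exec (?c r) s ((1 + dsize (s r)) + (t2 + ((1 + dsize (s r)) + (t4 + (1 + t5))))) s5"
        by (intro exec.Seq[OF 1] exec.Seq[OF 2(1)] exec.Seq[OF 3] exec.Seq[OF 4(1)] 5)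
      moreover have "s5 r = h (f (s r)) (g (s r))" by (simp add: s5_def)
      moreover have "\<forall>i<r. s5 i = s i"
        using 2 4 by (simp add: s5_def s3_def)
      ultimately show ?thesis by (intro exI conjI)
    qed
  qed
qed

lemma polytime_Cons: "polytime f \<Longrightarrow> polytime g \<Longrightarrow> polytime (\<lambda>x. Cons_d (f x) (g x))"
  by (rule polytime_binop[where h = Cons_d and e = "\<lambda>i j. Cons_e (Var i) (Var j)" and q = "[:2, 3:]"]) auto

lemma polytime_If:
  assumes "polytime b" "polytime f" "polytime g"
  shows "polytime (\<lambda>x. if b x \<noteq> Nil_d then f x else g x)"
proof -
  from assms(1) obtain B p1 where B: "runs_in B b p1" by (rule polytimeE)
  from assms(2) obtain C p2 where C: "runs_in C f p2" by (rule polytimeE)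
  from assms(3) obtain D p3 where D: "runs_in D g p3" by (rule polytimeE)
  let ?p = "[:2, 1:] + p1 + (p2 + p3)"
  \<comment> \<open>The test is evaluated on a copy in \<open>Suc r\<close>, so either branch still
    finds the input in \<open>r\<close>.\<close>
  let ?c = "\<lambda>r. Seq (Assign (Suc r) (Var r)) (Seq (B (Suc r)) (Cond (Var (Suc r)) (C r) (D r)))"
  show ?thesis
  proof (rule polytimeI[where p = ?p and C = ?c])
    fix r s
    show "\<exists>t s'. exec (?c r) s t s' \<and> s' r = (if b (s r) \<noteq> Nil_d then f (s r) else g (s r)) \<and> (\<forall>i<r. s' i = s i) \<and>
      t + dsize (if b (s r) \<noteq> Nil_d then f (s r) else g (s r)) \<le> poly ?p (dsize (s r))"
    proof -
      define s1 where "s1 = s(Suc r := s r)"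
      have 1: "exec (Assign (Suc r) (Var r)) s (1 + dsize (s r)) s1"
        using exec.Assign[of "Suc r" "Var r" s] by (simp add: s1_def)
      obtain t2 s2 where 2: "exec (B (Suc r)) s1 t2 s2" "s2 (Suc r) = b (s r)" "\<forall>i\<le>r. s2 i = s i"
        "t2 + dsize (b (s r)) \<le> poly p1 (dsize (s r))" using runs_inD[OF B, of "Suc r" s1] by (auto simp: s1_def)
      show ?thesis
      proof (cases "b (s r) = Nil_d")
        case False
        obtain t3 s3 where 3: "exec (C r) s2 t3 s3" "s3 r = f (s r)" "\<forall>i<r. s3 i = s i"
          "t3 + dsize (f (s r)) \<le> poly p2 (dsize (s r))" using runs_inD[OF C, of r s2] 2 by auto
        have "exec (?c r) s ((1 + dsize (s r)) + (t2 + (1 + cost_e (Var (Suc r)) s2 + t3))) s3"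
          using False 2 by (intro exec.Seq[OF 1] exec.Seq[OF 2(1)] exec.CondTrue[OF _ 3(1)]) auto
        then show ?thesis using False 2 3
          by (intro exI[of _ "(1 + dsize (s r)) + (t2 + (1 + cost_e (Var (Suc r)) s2 + t3))"] exI[of _ s3]) simp
      next
        case True
        obtain t3 s3 where 3: "exec (D r) s2 t3 s3" "s3 r = g (s r)" "\<forall>i<r. s3 i = s i"
          "t3 + dsize (g (s r)) \<le> poly p3 (dsize (s r))" using runs_inD[OF D, of r s2] 2 by auto
        have "exec (?c r) s ((1 + dsize (s r)) + (t2 + (1 + cost_e (Var (Suc r)) s2 + t3))) s3"
          using True 2 by (intro exec.Seq[OF 1] exec.Seq[OF 2(1)] exec.CondFalse[OF _ 3(1)]) auto
        then show ?thesis using True 2 3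
          by (intro exI[of _ "(1 + dsize (s r)) + (t2 + (1 + cost_e (Var (Suc r)) s2 + t3))"] exI[of _ s3]) simp
      qed
    qed
  qed
qed

text \<open>The only use of \<open>While\<close>; all other iterations are derived from it.
  Iterating a polynomial-time step can produce exponentially large values, so \<open>size\<close>
  demands a polynomial bound on the accumulator, for all prefixes of the list that the loop passes
  through.\<close>

lemma polytime_fold:
  fixes q :: "nat poly"
  assumes "polytime (\<lambda>x. list_d (l x))" "polytime i"
    and "polytime (\<lambda>z. h (hd_d z) (hd_d (tl_d z)) (tl_d (tl_d z)))"
    and size: "\<And>x ys zs. l x = ys @ zs \<Longrightarrow> dsize (fold (\<lambda>y a. h y a x) ys (i x)) \<le> poly q (dsize x)"
  shows "polytime (\<lambda>x. fold (\<lambda>y a. h y a x) (l x) (i x))"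
proof -
  from assms(1) obtain L p1 where L: "runs_in L (\<lambda>x. list_d (l x)) p1" by (rule polytimeE)
  from assms(2) obtain I p2 where I: "runs_in I i p2" by (rule polytimeE)
  \<comment> \<open>The step as a function of one tree that holds the element, the accumulator and
    the input.\<close>
  define h' where "h' z = h (hd_d z) (hd_d (tl_d z)) (tl_d (tl_d z))" for z
  have h': "h y a x = h' (Cons_d y (Cons_d a x))" for y a x by (simp add: h'_def)
  from assms(3) have "polytime h'" by (simp only: h'_def[abs_def])
  then obtain H p3 where H: "runs_in H h' p3" by (rule polytimeE)
  define F where "F x ys = fold (\<lambda>y a. h y a x) ys (i x)" for x ys
  \<comment> \<open>\<open>?z\<close> bounds the joint size of remaining list, accumulator and
    input, plus 2 for the cells that combine them, hence the argument of \<open>H\<close>.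
    \<open>B\<close> bounds one round: the factor 6 is 5 for the assignments of the body and 1 for
    the loop test.\<close>
  let ?z = "[:2, 1:] + p1 + q"
  define B where "B = smult 6 ?z + pcompose p3 ?z"
  let ?p = "[:4, 2:] + p1 + p2 + (1 + p1) * B + smult 2 q"
  \<comment> \<open>Register \<open>r\<close> holds the input, \<open>Suc r\<close> the remaining
    list, \<open>r + 2\<close> the accumulator; the step is run from \<open>r + 3\<close>
    on.\<close>
  define body where "body r = Seq (Assign (r + 3) (Cons_e (Hd_e (Var (Suc r))) (Cons_e (Var (r + 2)) (Var r))))
      (Seq (H (r + 3)) (Seq (Assign (r + 2) (Var (r + 3))) (Assign (Suc r) (Tl_e (Var (Suc r))))))" for r
  let ?c = "\<lambda>r. Seq (Assign (Suc r) (Var r)) (Seq (L (Suc r)) (Seq (Assign (r + 2) (Var r))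
       (Seq (I (r + 2)) (Seq (While (Var (Suc r)) (body r)) (Assign r (Var (r + 2)))))))"
    have body: "\<exists>t s'. exec (body r) s t s' \<and> s' (Suc r) = list_d zs \<and> s' (r + 2) = h y (s (r + 2)) (s r) \<and>
        (\<forall>i\<le>r. s' i = s i) \<and> t \<le> 5 * n + poly p3 n"
      if "s (Suc r) = list_d (y # zs)" and n: "n = 2 + dsize (s (Suc r)) + dsize (s (r + 2)) + dsize (s r)"
      for r s y zs n
    proof -
      define z where "z = Cons_d y (Cons_d (s (r + 2)) (s r))"
      define s1 where "s1 = s(r + 3 := z)"
      define t1 where "t1 = cost_e (Cons_e (Hd_e (Var (Suc r))) (Cons_e (Var (r + 2)) (Var r))) s"
      have 1: "exec (Assign (r + 3) (Cons_e (Hd_e (Var (Suc r))) (Cons_e (Var (r + 2)) (Var r)))) s (1 + t1) s1"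
        using exec.Assign[of "r + 3" "Cons_e (Hd_e (Var (Suc r))) (Cons_e (Var (r + 2)) (Var r))" s] that
        by (simp add: s1_def t1_def z_def)
      have t1: "t1 + 3 \<le> 3 * n"
        using that by (simp add: t1_def)
      obtain t2 s2 where 2: "exec (H (r + 3)) s1 t2 s2" "s2 (r + 3) = h' z" "\<forall>i<r+3. s2 i = s i"
        "t2 + dsize (h' z) \<le> poly p3 (dsize z)" using runs_inD[OF H, of "r + 3" s1] by (auto simp: s1_def)
      define s3 where "s3 = s2(r + 2 := h' z)"
      have 3: "exec (Assign (r + 2) (Var (r + 3))) s2 (1 + dsize (h' z)) s3"
        using exec.Assign[of "r + 2" "Var (r + 3)" s2] 2 by (simp add: s3_def)
      define s4 where "s4 = s3(Suc r := list_d zs)"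
      have 4: "exec (Assign (Suc r) (Tl_e (Var (Suc r)))) s3 (1 + (dsize (s (Suc r)) + dsize (list_d zs))) s4"
        using exec.Assign[of "Suc r" "Tl_e (Var (Suc r))" s3] 2 that by (simp add: s4_def s3_def)
      let ?t = "(1 + t1) + (t2 + ((1 + dsize (h' z)) + (1 + (dsize (s (Suc r)) + dsize (list_d zs)))))"
      have "exec (body r) s ?t s4"
        unfolding body_def by (intro exec.Seq[OF 1] exec.Seq[OF 2(1)] exec.Seq[OF 3] 4)
      moreover have "poly p3 (dsize z) \<le> poly p3 n"
        using that by (intro poly_nat_mono) (simp add: z_def)
      then have "?t \<le> 5 * n + poly p3 n"
        using 2(4) t1 that by simp
      ultimately show ?thesis
        using 2 by (intro exI[of _ ?t] exI[of _ s4]) (simp add: s4_def s3_def h' z_def)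
    qed
    \<comment> \<open>Loop invariant: \<open>zs\<close> is the unprocessed suffix and
      \<open>r + 2\<close> holds the fold over the processed prefix \<open>ys\<close>. The
      \<open>+ 1\<close> in the time bound pays for the final failing test.\<close>
    have loop: "\<exists>t s'. exec (While (Var (Suc r)) (body r)) s t s' \<and> s' (r + 2) = F x (l x) \<and>
        (\<forall>i\<le>r. s' i = s i) \<and> t \<le> (length zs + 1) * poly B (dsize x)"
      if "s (Suc r) = list_d zs" "s (r + 2) = F x ys" "s r = x" "l x = ys @ zs" for r s x ys zs
      using that
    proof (induction zs arbitrary: s ys)
      case Nil
      have "2 \<le> poly B (dsize x)"
        by (simp add: B_def)
      then show ?case
        using Nil exec.WhileFalse[of "Var (Suc r)" s "body r"] by (intro exI[of _ "Suc 1"] exI[of _ s]) simp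
    next
      case (Cons y zs)
      define n where "n = 2 + dsize (s (Suc r)) + dsize (s (r + 2)) + dsize (s r)"
      define m where "m = poly ?z (dsize x)"
      obtain t s' where 1: "exec (body r) s t s'" "s' (Suc r) = list_d zs"
        "s' (r + 2) = h y (s (r + 2)) (s r)" "\<forall>i\<le>r. s' i = s i" "t \<le> 5 * n + poly p3 n"
        using body[OF Cons.prems(1) n_def] by blast
      have "s' (r + 2) = F x (ys @ [y])"
        using 1 Cons.prems by (simp add: F_def)
      moreover have "l x = (ys @ [y]) @ zs" using Cons.prems by simp
      moreover have "s' r = x" using 1 Cons.prems by simp
      ultimately obtain t' s'' where 2: "exec (While (Var (Suc r)) (body r)) s' t' s''" "s'' (r + 2) = F x (l x)"
        "\<forall>i\<le>r. s'' i = s' i" "t' \<le> (length zs + 1) * poly B (dsize x)"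
        using Cons.IH[of s' "ys @ [y]"] 1(2) by blast
      have "dsize (list_d (y # zs)) \<le> dsize (list_d (l x))"
        using dsize_list_d_append[of ys "y # zs"] Suc_leI[OF dsize_pos[of "list_d ys"]] Cons.prems by simp
      also have "\<dots> \<le> poly p1 (dsize x)"
        using runs_inD[OF L, of 0 "\<lambda>_. x"] by auto
      finally have "n \<le> m"
        using Cons.prems size[of x ys "y # zs"] by (simp add: n_def m_def F_def)
      moreover from this have "poly p3 n \<le> poly p3 m"
        by (rule poly_nat_mono)
      moreover have "poly B (dsize x) = 6 * m + poly p3 m"
        by (simp only: B_def m_def poly_add poly_smult poly_pcompose)
      moreover have "1 + dsize (s (Suc r)) \<le> n" by (simp add: n_def)
      ultimately have "1 + dsize (s (Suc r)) + t \<le> poly B (dsize x)"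
        using 1(5) by linarith
      then have "1 + dsize (s (Suc r)) + t + t' \<le> (length (y # zs) + 1) * poly B (dsize x)"
        using 2(4) by simp
      moreover have "exec (While (Var (Suc r)) (body r)) s (1 + cost_e (Var (Suc r)) s + t + t') s''"
        using Cons.prems by (intro exec.WhileTrue[OF _ 1(1) 2(1)]) simp
      ultimately show ?case using 1(4) 2(2,3)
        by (intro exI[of _ "1 + dsize (s (Suc r)) + t + t'"] exI[of _ s'']) simp
    qed
  show ?thesis
  proof (rule polytimeI[where p = ?p and C = ?c])
    fix r s
    show "\<exists>t s'. exec (?c r) s t s' \<and> s' r = fold (\<lambda>y a. h y a (s r)) (l (s r)) (i (s r)) \<and> (\<forall>i<r. s' i = s i) \<and>
      t + dsize (fold (\<lambda>y a. h y a (s r)) (l (s r)) (i (s r))) \<le> poly ?p (dsize (s r))"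
    proof -
      define x where "x = s r"
      define s1 where "s1 = s(Suc r := x)"
      have 1: "exec (Assign (Suc r) (Var r)) s (1 + dsize x) s1"
        using exec.Assign[of "Suc r" "Var r" s] by (simp add: s1_def x_def)
      obtain t2 s2 where 2: "exec (L (Suc r)) s1 t2 s2" "s2 (Suc r) = list_d (l x)" "\<forall>i\<le>r. s2 i = s i"
        "t2 + dsize (list_d (l x)) \<le> poly p1 (dsize x)" using runs_inD[OF L, of "Suc r" s1] by (auto simp: s1_def)
      define s3 where "s3 = s2(r + 2 := x)"
      have 3: "exec (Assign (r + 2) (Var r)) s2 (1 + dsize x) s3"
        using exec.Assign[of "r + 2" "Var r" s2] 2 by (simp add: s3_def x_def)
      obtain t4 s4 where 4: "exec (I (r + 2)) s3 t4 s4" "s4 (r + 2) = i x" "\<forall>i\<le>Suc r. s4 i = s3 i"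
        "t4 + dsize (i x) \<le> poly p2 (dsize x)" using runs_inD[OF I, of "r + 2" s3] by (auto simp: s3_def less_Suc_eq_le)
      have s4: "s4 (Suc r) = list_d (l x)" "\<forall>i\<le>r. s4 i = s i"
        using 2 4 by (auto simp: s3_def)
      obtain t5 s5 where 5: "exec (While (Var (Suc r)) (body r)) s4 t5 s5" "s5 (r + 2) = F x (l x)"
        "\<forall>i\<le>r. s5 i = s4 i" "t5 \<le> (length (l x) + 1) * poly B (dsize x)"
        using loop[where r = r and s = s4 and zs = "l x" and x = x and ys = "[]"] s4 4(2) by (auto simp: F_def x_def)
      define s6 where "s6 = s5(r := F x (l x))"
      have 6: "exec (Assign r (Var (r + 2))) s5 (1 + dsize (F x (l x))) s6"
        using exec.Assign[of r "Var (r + 2)" s5] 5 by (simp add: s6_def)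
      let ?t = "(1 + dsize x) + (t2 + ((1 + dsize x) + (t4 + (t5 + (1 + dsize (F x (l x)))))))"
      have "exec (?c r) s ?t s6"
        by (intro exec.Seq[OF 1] exec.Seq[OF 2(1)] exec.Seq[OF 3] exec.Seq[OF 4(1)] exec.Seq[OF 5(1)] 6)
      moreover have "length (l x) \<le> poly p1 (dsize x)"
        using length_le_dsize[of "l x"] 2(4) by linarith
      then have "(length (l x) + 1) * poly B (dsize x) \<le> (poly p1 (dsize x) + 1) * poly B (dsize x)"
        by (intro mult_le_mono1) simp
      from order_trans[OF 5(4) this] have "t5 \<le> poly ((1 + p1) * B) (dsize x)"
        by (simp add: algebra_simps)
      moreover have "dsize (F x (l x)) \<le> poly q (dsize x)"
        using size[of x "l x" "[]"] by (simp add: F_def)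
      ultimately show ?thesis
        using 2(4) 4(4) 5(3) s4(2)
        by (intro exI[of _ ?t] exI[of _ s6]) (simp add: s6_def F_def x_def)
    qed
  qed
qed

section \<open>Decision procedures with values in \<open>bool_d\<close>\<close>

lemma polytime_if:
  "polytime (\<lambda>x. bool_d (P x)) \<Longrightarrow> polytime f \<Longrightarrow> polytime g \<Longrightarrow> polytime (\<lambda>x. if P x then f x else g x)"
  using polytime_If[of "\<lambda>x. bool_d (P x)" f g] by simp

lemma polytime_pred_Not:
  "polytime (\<lambda>x. bool_d (P x)) \<Longrightarrow> polytime (\<lambda>x. bool_d (\<not> P x))"
proof -
  have bool_eq: "bool_d (\<not> P) = (if P then bool_d False else bool_d True)" for P Q by simp
  assume "polytime (\<lambda>x. bool_d (P x))"
  then show ?thesis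
    unfolding bool_eq by (intro polytime_if polytime_const)
qed

lemma polytime_list_if:
  "polytime (\<lambda>x. bool_d (P x)) \<Longrightarrow> polytime (\<lambda>x. list_d (f x)) \<Longrightarrow> polytime (\<lambda>x. list_d (g x)) \<Longrightarrow>
    polytime (\<lambda>x. list_d (if P x then f x else g x))"
  using polytime_if[of P "\<lambda>x. list_d (f x)" "\<lambda>x. list_d (g x)"] by (simp add: if_distrib)

lemma polytime_pred_conj:
  "polytime (\<lambda>x. bool_d (P x)) \<Longrightarrow> polytime (\<lambda>x. bool_d (Q x)) \<Longrightarrow> polytime (\<lambda>x. bool_d (P x \<and> Q x))"
proof -
  have bool_eq: "bool_d (P \<and> Q) = (if P then bool_d Q else bool_d False)" for P Q by simp
  assume "polytime (\<lambda>x. bool_d (P x))" "polytime (\<lambda>x. bool_d (Q x))"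
  then show ?thesis
    unfolding bool_eq by (intro polytime_if polytime_const)
qed

lemma polytime_pred_disj:
  "polytime (\<lambda>x. bool_d (P x)) \<Longrightarrow> polytime (\<lambda>x. bool_d (Q x)) \<Longrightarrow> polytime (\<lambda>x. bool_d (P x \<or> Q x))"
proof -
  have bool_eq: "bool_d (P \<or> Q) = (if P then bool_d True else bool_d Q)" for P Q by simp
  assume "polytime (\<lambda>x. bool_d (P x))" "polytime (\<lambda>x. bool_d (Q x))"
  then show ?thesis
    unfolding bool_eq by (intro polytime_if polytime_const)
qed

lemma polytime_pred_imp:
  "polytime (\<lambda>x. bool_d (P x)) \<Longrightarrow> polytime (\<lambda>x. bool_d (Q x)) \<Longrightarrow> polytime (\<lambda>x. bool_d (P x \<longrightarrow> Q x))"
  unfolding imp_conv_disj by (intro polytime_pred_disj polytime_pred_Not)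

lemma polytime_pred_eq:
  assumes "polytime f" "polytime g"
  shows "polytime (\<lambda>x. bool_d (f x = g x))"
  by (rule polytime_binop[OF assms, where e = "\<lambda>i j. Eq_e (Var i) (Var j)" and q = "[:6, 1:]"])
    (auto simp: bool_d_def)

lemma polytime_pred_test: "polytime f \<Longrightarrow> polytime (\<lambda>x. bool_d (f x \<noteq> Nil_d))"
  by (intro polytime_pred_Not polytime_pred_eq polytime_const)

section \<open>List operations and quantifiers bounded by lists\<close>

lemma polytime_list_Nil: "polytime (\<lambda>_. list_d [])"
  by (rule polytime_const)

lemma polytime_list_Cons:
  "polytime f \<Longrightarrow> polytime (\<lambda>x. list_d (l x)) \<Longrightarrow> polytime (\<lambda>x. list_d (f x # l x))"
  using polytime_Cons by simp

lemma polytime_dlist: "polytime f \<Longrightarrow> polytime (\<lambda>x. list_d (dlist (f x)))"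
  by simp

lemma fold_Cons_d: "fold Cons_d xs (list_d ys) = list_d (rev xs @ ys)"
  by (induction xs arbitrary: ys) (simp_all flip: list_d.simps(2))

lemma polytime_list_rev:
  assumes "polytime (\<lambda>x. list_d (l x))"
  shows "polytime (\<lambda>x. list_d (rev (l x)))"
proof -
  obtain p :: "nat poly" where p: "\<And>x. dsize (list_d (l x)) \<le> poly p (dsize x)"
    using assms by (rule polytime_size) blast
  have "polytime (\<lambda>x. fold (\<lambda>y a. Cons_d y a) (l x) Nil_d)"
  proof (rule polytime_fold[where q = p])
    show "dsize (fold Cons_d ys Nil_d) \<le> poly p (dsize x)" if "l x = ys @ zs" for x ys zs
      using fold_Cons_d[of ys "[]"] dsize_list_d_append[of ys zs] dsize_pos[of "list_d zs"] p[of x] that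
      by (simp add: dsize_list_d rev_map[symmetric])
  qed (intro assms polytime_const polytime_Cons polytime_hd polytime_tl polytime_id)+
  then show ?thesis
    using fold_Cons_d[of _ "[]"] by simp
qed

lemma polytime_list_append:
  assumes "polytime (\<lambda>x. list_d (l x))" "polytime (\<lambda>x. list_d (m x))"
  shows "polytime (\<lambda>x. list_d (l x @ m x))"
proof -
  obtain p :: "nat poly" where p: "\<And>x. dsize (list_d (l x)) \<le> poly p (dsize x)"
    using assms(1) by (rule polytime_size) blast
  obtain q :: "nat poly" where q: "\<And>x. dsize (list_d (m x)) \<le> poly q (dsize x)"
    using assms(2) by (rule polytime_size) blast
  have "polytime (\<lambda>x. fold (\<lambda>y a. Cons_d y a) (rev (l x)) (list_d (m x)))"
  proof (rule polytime_fold[where q = "p + q"])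
    show "dsize (fold Cons_d ys (list_d (m x))) \<le> poly (p + q) (dsize x)" if "rev (l x) = ys @ zs" for x ys zs
    proof -
      from that have "l x = rev zs @ rev ys" by (metis rev_append rev_rev_ident)
      then show ?thesis
        using dsize_list_d_append[of "rev zs" "rev ys"] dsize_list_d_append[of "rev ys" "m x"]
          dsize_pos[of "list_d (rev zs)"] p[of x] q[of x]
        by (simp add: fold_Cons_d)
    qed
  qed (intro assms polytime_const polytime_Cons polytime_hd polytime_tl polytime_id polytime_list_rev)+
  then show ?thesis
    by (simp add: fold_Cons_d)
qed

lemma dsize_concat_map_le:
  "\<forall>y\<in>set ys. dsize (list_d (f y)) \<le> b \<Longrightarrow> dsize (list_d (concat (map f ys))) \<le> 1 + length ys * b"
proof (induction ys)
  case (Cons y ys)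
  then show ?case using dsize_list_d_append[of "f y" "concat (map f ys)"] by simp
qed simp

text \<open>Map, filter and bounded quantifiers are special cases. The inner function receives the
  pair of the element and the outer input, so it may refer to both; writing these as
  \<open>hd_d z\<close> and \<open>tl_d z\<close> lets nested binders be resolved by repeated
  application of such rules.\<close>

lemma polytime_list_concat_map:
  assumes "polytime (\<lambda>x. list_d (l x))"
    and "polytime (\<lambda>z. list_d (m (hd_d z) (tl_d z)))"
  shows "polytime (\<lambda>x. list_d (concat (map (\<lambda>y. m y x) (l x))))"
proof -
  obtain p :: "nat poly" where p: "\<And>x. dsize (list_d (l x)) \<le> poly p (dsize x)"
    using assms(1) by (rule polytime_size) blast
  obtain q :: "nat poly" where q: "\<And>z. dsize (list_d (m (hd_d z) (tl_d z))) \<le> poly q (dsize z)"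
    using assms(2) by (rule polytime_size) blast
  have F: "fold (\<lambda>y a. list_d (m y x @ dlist a)) ys Nil_d = list_d (concat (map (\<lambda>y. m y x) (rev ys)))" for x ys
    by (induction ys rule: rev_induct) auto
  \<comment> \<open>At most \<open>p\<close> elements, each contributing the output size of
    \<open>m\<close> on a pair of size at most \<open>1 + dsize x + p\<close>.\<close>
  let ?q = "1 + p * pcompose q ([:1, 1:] + p)"
  \<comment> \<open>Each step prepends to the accumulator, so the list is traversed
    backwards.\<close>
  have "polytime (\<lambda>x. fold (\<lambda>y a. list_d (m y x @ dlist a)) (rev (l x)) Nil_d)"
  proof (rule polytime_fold[where q = ?q])
    have "polytime (\<lambda>z. list_d (m (hd_d (Cons_d (hd_d z) (tl_d (tl_d z)))) (tl_d (Cons_d (hd_d z) (tl_d (tl_d z))))))"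
      by (rule polytime_comp[OF assms(2)]) (intro polytime_Cons polytime_hd polytime_tl polytime_id)
    then show "polytime (\<lambda>z. list_d (m (hd_d z) (tl_d (tl_d z)) @ dlist (hd_d (tl_d z))))"
      by (intro polytime_list_append polytime_dlist polytime_hd polytime_tl polytime_id) simp
    show "dsize (fold (\<lambda>y a. list_d (m y x @ dlist a)) ys Nil_d) \<le> poly ?q (dsize x)"
      if "rev (l x) = ys @ zs" for x ys zs
    proof -
      let ?b = "poly (pcompose q ([:1, 1:] + p)) (dsize x)"
      have "dsize (list_d (m y x)) \<le> ?b" if "y \<in> set (l x)" for y
      proof -
        have "dsize (list_d (m y x)) \<le> poly q (dsize (Cons_d y x))"
          using q[of "Cons_d y x"] by simp
        also have "\<dots> \<le> ?b"
          unfolding poly_pcompose using dsize_member[OF that] p[of x] by (intro poly_nat_mono) simp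
        finally show ?thesis .
      qed
      moreover from that have "set ys \<subseteq> set (l x)" and len: "length ys \<le> length (l x)"
        by (metis set_append set_rev sup_ge1) (metis length_append length_rev le_add1 that)
      ultimately have "\<forall>y\<in>set (rev ys). dsize (list_d (m y x)) \<le> ?b" by auto
      then have "dsize (list_d (concat (map (\<lambda>y. m y x) (rev ys)))) \<le> 1 + length (rev ys) * ?b"
        by (rule dsize_concat_map_le)
      also have "length (rev ys) \<le> poly p (dsize x)"
        using len length_le_dsize[of "l x"] p[of x] by simp
      finally show ?thesis by (simp add: F)
    qed
  qed (intro assms polytime_const polytime_list_rev)+
  then show ?thesis
    by (simp add: F)
qed

lemma polytime_list_map:
  assumes "polytime (\<lambda>x. list_d (l x))" "polytime (\<lambda>z. f (hd_d z) (tl_d z))"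
  shows "polytime (\<lambda>x. list_d (map (\<lambda>y. f y x) (l x)))"
proof -
  have "polytime (\<lambda>x. list_d (concat (map (\<lambda>y. [f y x]) (l x))))"
    by (intro polytime_list_concat_map[where m = "\<lambda>y x. [f y x]"] polytime_list_Cons polytime_list_Nil assms)
  then show ?thesis by (simp add: concat_map_singleton)
qed

lemma polytime_list_filter:
  assumes "polytime (\<lambda>x. list_d (l x))" "polytime (\<lambda>z. bool_d (P (hd_d z) (tl_d z)))"
  shows "polytime (\<lambda>x. list_d (filter (\<lambda>y. P y x) (l x)))"
proof -
  have "polytime (\<lambda>x. list_d (concat (map (\<lambda>y. if P y x then [y] else []) (l x))))"
    by (intro polytime_list_concat_map[where m = "\<lambda>y x. if P y x then [y] else []"]
        polytime_list_Cons polytime_list_Nil polytime_list_if polytime_hd polytime_id assms)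
  moreover have "concat (map (\<lambda>y. if P y x then [y] else []) ys) = filter (\<lambda>y. P y x) ys" for x ys
    by (induction ys) auto
  ultimately show ?thesis by simp
qed

lemma polytime_pred_Bex:
  assumes "polytime (\<lambda>x. list_d (l x))" "polytime (\<lambda>z. bool_d (P (hd_d z) (tl_d z)))"
  shows "polytime (\<lambda>x. bool_d (\<exists>y\<in>set (l x). P y x))"
proof -
  have "polytime (\<lambda>x. bool_d (list_d (filter (\<lambda>y. P y x) (l x)) \<noteq> Nil_d))"
    by (intro polytime_pred_test polytime_list_filter assms)
  then show ?thesis by (simp add: filter_empty_conv)
qed

lemma polytime_pred_Ball:
  assumes "polytime (\<lambda>x. list_d (l x))" "polytime (\<lambda>z. bool_d (P (hd_d z) (tl_d z)))"
  shows "polytime (\<lambda>x. bool_d (\<forall>y\<in>set (l x). P y x))"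
proof -
  have "polytime (\<lambda>x. bool_d (\<not> (\<exists>y\<in>set (l x). \<not> P y x)))"
    by (intro polytime_pred_Not polytime_pred_Bex assms)
  then show ?thesis by simp
qed

lemma polytime_pred_member:
  assumes "polytime f" "polytime (\<lambda>x. list_d (l x))"
  shows "polytime (\<lambda>x. bool_d (f x \<in> set (l x)))"
proof -
  have "polytime (\<lambda>z. f (tl_d z))"
    by (intro polytime_comp[OF assms(1)] polytime_tl polytime_id)
  then have "polytime (\<lambda>x. bool_d (\<exists>y\<in>set (l x). y = f x))"
    by (intro polytime_pred_Bex[where P = "\<lambda>y x. y = f x"] polytime_pred_eq polytime_hd polytime_id assms)
  then show ?thesis by simp
qed

lemma polytime_list_take_1:
  assumes "polytime (\<lambda>x. list_d (l x))"
  shows "polytime (\<lambda>x. list_d (take 1 (l x)))"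
proof -
  have "polytime (\<lambda>x. if list_d (l x) \<noteq> Nil_d then list_d [hd_d (list_d (l x))] else list_d [])"
    by (intro polytime_If polytime_list_Cons polytime_list_Nil polytime_hd assms)
  moreover have "(if list_d xs \<noteq> Nil_d then list_d [hd_d (list_d xs)] else list_d []) = list_d (take 1 xs)" for xs
    by (cases xs) auto
  ultimately show ?thesis by simp
qed

lemma polytime_list_take_2:
  assumes "polytime (\<lambda>x. list_d (l x))"
  shows "polytime (\<lambda>x. list_d (take 2 (l x)))"
proof -
  have "polytime (\<lambda>x. list_d (take 1 (l x) @ take 1 (dlist (tl_d (list_d (l x))))))"
    by (intro polytime_list_append polytime_list_take_1 polytime_dlist polytime_tl assms)
  moreover have "take 1 xs @ take 1 (dlist (tl_d (list_d xs))) = take 2 xs" for xs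
    by (cases xs) (auto simp: numeral_2_eq_2)
  ultimately show ?thesis by simp
qed

section \<open>Unary numerals and indexing\<close>

definition nth_d :: "data \<Rightarrow> data \<Rightarrow> data" where
  "nth_d d u = hd_d (fold (\<lambda>_. tl_d) (dlist u) d)"

definition num_d :: "nat \<Rightarrow> data" where
  "num_d i = list_d (replicate i Nil_d)"

lemma num_d_eq_iff [simp]: "num_d i = num_d j \<longleftrightarrow> i = j"
  unfolding num_d_def by (metis dlist_list_d length_replicate)

lemma dsize_num_d: "dsize (num_d i) = 1 + 2 * i"
  by (induction i) (auto simp: num_d_def)

text \<open>A unary numeral is itself a list, so indexing is a fold that discards one cell per entry
  of the numeral and needs no arithmetic.\<close>

lemma nth_d_list_d:
  assumes "i < length xs"
  shows "nth_d (list_d xs) (num_d i) = xs ! i"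
proof -
  have "fold (\<lambda>_. tl_d) (replicate i Nil_d) (list_d ys) = list_d (drop i ys)" for ys
    by (induction i arbitrary: ys) (auto simp: tl_d_list_d drop_Suc)
  then show ?thesis
    using assms by (simp add: nth_d_def num_d_def hd_d_list_d hd_drop_conv_nth)
qed

lemma polytime_nth_d:
  assumes "polytime f" "polytime g"
  shows "polytime (\<lambda>x. nth_d (f x) (g x))"
  unfolding nth_d_def
proof (rule polytime_hd)
  obtain p :: "nat poly" where p: "\<And>x. dsize (f x) \<le> poly p (dsize x)"
    using assms(1) by (rule polytime_size) blast
  show "polytime (\<lambda>x. fold (\<lambda>_. tl_d) (dlist (g x)) (f x))"
  proof (rule polytime_fold[where q = p])
    show "dsize (fold (\<lambda>_. tl_d) ys (f x)) \<le> poly p (dsize x)" for x ys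
    proof -
      have "dsize (fold (\<lambda>_. tl_d) ys d) \<le> dsize d" for d
        by (induction ys arbitrary: d) (auto intro: order_trans[OF _ dsize_tl_d])
      then show ?thesis using p order_trans by blast
    qed
  qed (intro assms polytime_dlist polytime_hd polytime_tl polytime_id)+
qed

lemma polytime_list_numerals:
  assumes "polytime (\<lambda>x. list_d (l x))"
  shows "polytime (\<lambda>x. list_d (map num_d [0..<length (l x)]))"
proof -
  obtain p :: "nat poly" where p: "\<And>x. dsize (list_d (l x)) \<le> poly p (dsize x)"
    using assms by (rule polytime_size) blast
  \<comment> \<open>The accumulator lists the numerals in descending order and its head yields the
    next one. Starting from zero gives one numeral too many, the length itself, which
    \<open>tl_d\<close> removes before the final reversal.\<close>
  let ?h = "\<lambda>_ a. Cons_d (Cons_d Nil_d (hd_d a)) a"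
  have F: "fold ?h ys (list_d [Nil_d]) = list_d (rev (map num_d [0..<Suc (length ys)]))" for ys :: "data list"
    by (induction ys rule: rev_induct) (auto simp: num_d_def)
  have S: "dsize (list_d (rev (map num_d [0..<n]))) \<le> 1 + n * (2 + 2 * n)" for n
    by (induction n) (auto simp: dsize_num_d)
  have fold_h: "polytime (\<lambda>x. fold ?h (l x) (list_d [Nil_d]))"
  proof (rule polytime_fold[where q = "1 + (1 + p) * (4 + smult 2 p)"])
    show "dsize (fold ?h ys (list_d [Nil_d])) \<le> poly (1 + (1 + p) * (4 + smult 2 p)) (dsize x)"
      if "l x = ys @ zs" for x ys zs
    proof -
      have "length ys \<le> poly p (dsize x)"
        using length_le_dsize[of "l x"] p[of x] that by simp
      then have "1 + Suc (length ys) * (2 + 2 * Suc (length ys)) \<le>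
          1 + (1 + poly p (dsize x)) * (4 + 2 * poly p (dsize x))"
        by (intro add_left_mono mult_le_mono) simp_all
      then show ?thesis
        unfolding F using S[of "Suc (length ys)"] by (auto simp: numeral_poly)
    qed
  qed (intro assms polytime_const polytime_Cons polytime_hd polytime_tl polytime_id)+
  have "polytime (\<lambda>x. list_d (rev (dlist (tl_d (fold ?h (l x) (list_d [Nil_d]))))))"
    by (intro polytime_list_rev polytime_dlist polytime_tl fold_h)
  then show ?thesis unfolding F by simp
qed

lemma polytime_pred_iff:
  "polytime (\<lambda>x. bool_d (P x)) \<Longrightarrow> polytime (\<lambda>x. bool_d (Q x)) \<Longrightarrow> polytime (\<lambda>x. bool_d (P x \<longleftrightarrow> Q x))"
  unfolding iff_conv_conj_imp by (intro polytime_pred_conj polytime_pred_imp)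

lemma polytime_pred_nonempty:
  "polytime (\<lambda>x. list_d (l x)) \<Longrightarrow> polytime (\<lambda>x. bool_d (l x \<noteq> []))"
  using polytime_pred_Not[OF polytime_pred_eq[OF _ polytime_const[of Nil_d]], of "\<lambda>x. list_d (l x)"] by simp

lemmas polytime_intros =
  polytime_id polytime_const polytime_hd polytime_tl polytime_Cons polytime_nth_d polytime_if
  polytime_list_Nil polytime_list_Cons polytime_dlist polytime_list_append polytime_list_concat_map
  polytime_list_map polytime_list_filter polytime_list_take_1 polytime_list_take_2 polytime_list_numerals
  polytime_pred_Not polytime_pred_conj polytime_pred_disj polytime_pred_imp polytime_pred_eq
  polytime_pred_test polytime_pred_Bex polytime_pred_Ball polytime_pred_member polytime_pred_iff polytime_pred_nonempty

section \<open>Cuts in graphs with a cluster modulator\<close>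

text \<open>Stated for a vertex set and an adjacency predicate over any type, so that it applies
  both to the graph on \<open>nat\<close> and to the decoded graph on numerals. The cutset is the
  complement of \<open>A \<union> B\<close>.\<close>

definition has_cut :: "'a set \<Rightarrow> ('a \<Rightarrow> 'a \<Rightarrow> bool) \<Rightarrow> bool" where
  "has_cut V E \<longleftrightarrow> (\<exists>A B. A \<subseteq> V \<and> B \<subseteq> V \<and> A \<noteq> {} \<and> B \<noteq> {} \<and> A \<inter> B = {} \<and>
     (\<forall>a\<in>A. \<forall>b\<in>B. \<not> E a b) \<and> (\<forall>u\<in>V - (A \<union> B). \<forall>v\<in>V - (A \<union> B). \<not> E u v))"

lemma has_cutI:
  assumes "A \<subseteq> V" "B \<subseteq> V" "A \<noteq> {}" "B \<noteq> {}" "A \<inter> B = {}" "\<And>a b. a \<in> A \<Longrightarrow> b \<in> B \<Longrightarrow> \<not> E a b"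
    "\<And>u v. u \<in> V - (A \<union> B) \<Longrightarrow> v \<in> V - (A \<union> B) \<Longrightarrow> \<not> E u v"
  shows "has_cut V E"
  unfolding has_cut_def using assms by (intro exI[of _ A] exI[of _ B]) simp

lemma has_cut_image:
  assumes "has_cut V E" "inj_on f V" "\<And>u v. u \<in> V \<Longrightarrow> v \<in> V \<Longrightarrow> E' (f u) (f v) \<longleftrightarrow> E u v"
  shows "has_cut (f ` V) E'"
proof -
  obtain A B where AB: "A \<subseteq> V" "B \<subseteq> V" "A \<noteq> {}" "B \<noteq> {}" "A \<inter> B = {}"
    "\<forall>a\<in>A. \<forall>b\<in>B. \<not> E a b" "\<forall>u\<in>V - (A \<union> B). \<forall>v\<in>V - (A \<union> B). \<not> E u v"
    using assms(1) unfolding has_cut_def by blast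
  show ?thesis
  proof (rule has_cutI[of "f ` A" _ "f ` B"])
    show "f ` A \<inter> f ` B = {}" using AB(1,2,5) assms(2) by (auto dest: inj_onD)
    show "\<not> E' a b" if "a \<in> f ` A" "b \<in> f ` B" for a b
      using that AB(1,2,6) assms(3) by (auto simp: subset_iff)
    show "\<not> E' u v" if uv: "u \<in> f ` V - (f ` A \<union> f ` B)" "v \<in> f ` V - (f ` A \<union> f ` B)" for u v
    proof -
      obtain x y where "u = f x" "v = f y" "x \<in> V - (A \<union> B)" "y \<in> V - (A \<union> B)"
        using uv by blast
      then show ?thesis using AB(7) assms(3) by simp
    qed
  qed (use AB(1-4) in auto)
qed

lemma has_cut_image_iff:
  assumes "inj_on f V" "\<And>u v. u \<in> V \<Longrightarrow> v \<in> V \<Longrightarrow> E' (f u) (f v) \<longleftrightarrow> E u v"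
  shows "has_cut (f ` V) E' \<longleftrightarrow> has_cut V E"
proof
  assume "has_cut (f ` V) E'"
  then have "has_cut (the_inv_into V f ` (f ` V)) E"
    by (rule has_cut_image) (use assms in \<open>auto simp: the_inv_into_f_f inj_on_the_inv_into\<close>)
  then show "has_cut V E" using assms(1) by simp
next
  assume "has_cut V E"
  then show "has_cut (f ` V) E'"
    using assms by (rule has_cut_image)
qed

section \<open>Neighbourhood tests and the marking rule\<close>

definition clique_of :: "('a \<Rightarrow> bool) \<Rightarrow> ('a \<Rightarrow> 'a \<Rightarrow> bool) \<Rightarrow> 'a list \<Rightarrow> 'a \<Rightarrow> 'a list" where
  "clique_of X E vs u = filter (\<lambda>v. \<not> X v \<and> (v = u \<or> E u v)) vs"

definition nbrs :: "('a \<Rightarrow> 'a \<Rightarrow> bool) \<Rightarrow> 'a list \<Rightarrow> 'a list \<Rightarrow> 'a list" where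
  "nbrs E vs D = filter (\<lambda>v. v \<notin> set D \<and> (\<exists>d\<in>set D. E d v)) vs"

text \<open>Nonemptiness excludes \<open>K - {w}\<close> for a singleton clique \<open>{w}\<close>,
  whose empty neighbourhood would be vacuously stable.\<close>

definition stable_nbrs :: "('a \<Rightarrow> 'a \<Rightarrow> bool) \<Rightarrow> 'a list \<Rightarrow> 'a list \<Rightarrow> bool" where
  "stable_nbrs E vs D \<longleftrightarrow> D \<noteq> [] \<and> (\<forall>u\<in>set (nbrs E vs D). \<forall>v\<in>set (nbrs E vs D). \<not> E u v)"

definition separating_nbrs :: "('a \<Rightarrow> 'a \<Rightarrow> bool) \<Rightarrow> 'a list \<Rightarrow> 'a list \<Rightarrow> bool" where
  "separating_nbrs E vs D \<longleftrightarrow> stable_nbrs E vs D \<and> (\<exists>v\<in>set vs. v \<notin> set D \<and> v \<notin> set (nbrs E vs D))"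

text \<open>The singletons \<open>[u]\<close>, also those inside the modulator, are tested because
  \<open>no_cut_clique_plus_stable\<close> reduces cuts to neighbourhoods of single
  vertices.\<close>

definition easy_yes :: "('a \<Rightarrow> bool) \<Rightarrow> ('a \<Rightarrow> 'a \<Rightarrow> bool) \<Rightarrow> 'a list \<Rightarrow> bool" where
  "easy_yes X E vs \<longleftrightarrow> (\<exists>u\<in>set vs. separating_nbrs E vs [u] \<or>
     \<not> X u \<and> (separating_nbrs E vs (clique_of X E vs u) \<or>
       (\<exists>w\<in>set vs. separating_nbrs E vs (filter (\<lambda>v. v \<noteq> w) (clique_of X E vs u)))))"

text \<open>
  Only consulted when \<open>easy_yes\<close> fails. Then \<open>D\<close> together with its stable neighbourhood exhausts the
  graph, so every cut yields a single vertex whose neighbourhood is a stable cutset, which \<open>easy_yes\<close> has excluded.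
\<close>

definition easy_no :: "('a \<Rightarrow> bool) \<Rightarrow> ('a \<Rightarrow> 'a \<Rightarrow> bool) \<Rightarrow> 'a list \<Rightarrow> bool" where
  "easy_no X E vs \<longleftrightarrow> (\<exists>u\<in>set vs. \<not> X u \<and>
     (stable_nbrs E vs (clique_of X E vs u) \<or>
      (\<exists>w\<in>set vs. stable_nbrs E vs (filter (\<lambda>v. v \<noteq> w) (clique_of X E vs u)))))"

text \<open>
  Suppose \<open>b\<close> lies on the side \<open>B\<close> of a cut, and \<open>c\<close> lies on \<open>B\<close> if \<open>\<not> e\<close> and in the cutset if \<open>e\<close>.
  Then an attached clique \<open>K\<close> has a vertex on the side \<open>B\<close>.
\<close>

definition attached :: "('a \<Rightarrow> 'a \<Rightarrow> bool) \<Rightarrow> 'a list \<Rightarrow> bool \<Rightarrow> 'a \<Rightarrow> 'a \<Rightarrow> bool" where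
  "attached E K e b c \<longleftrightarrow> (\<exists>y\<in>set K. \<exists>z\<in>set K. E y b \<and> E z c \<and> (y = z \<longleftrightarrow> e))"

text \<open>
  Two neighbours of each \<open>x\<close> are kept so that deleting any one vertex from the reduced clique leaves the
  same neighbourhood in \<open>X\<close> as deleting it from \<open>K\<close>; this also yields the two distinct vertices required
  by \<open>attached\<close> for \<open>e = False\<close>.
\<close>

definition reduced_clique :: "('a \<Rightarrow> bool) \<Rightarrow> ('a \<Rightarrow> 'a \<Rightarrow> bool) \<Rightarrow> 'a list \<Rightarrow> 'a list \<Rightarrow> 'a \<Rightarrow> 'a \<Rightarrow> 'a \<Rightarrow> 'a \<Rightarrow> 'a list" where
  "reduced_clique X E vs K b c a d =
     take 1 (filter (\<lambda>y. E y b \<and> E y c) K) @ take 1 (filter (\<lambda>y. E y a \<and> E y d) K) @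
     concat (map (\<lambda>x. take 2 (filter (\<lambda>y. E y x) K)) (filter X vs))"

text \<open>The pair \<open>b\<close>, \<open>c\<close> with flag \<open>e\<close> is the pattern
  forcing a clique to one side, \<open>a\<close>, \<open>d\<close> with \<open>e'\<close> the
  pattern forcing it to the other. \<open>take 1\<close> keeps the first vertex whose clique shows
  both. The nested \<open>concat\<close> and \<open>map\<close> fit the polynomial-time rules as
  well as the length bound.\<close>

definition marked :: "('a \<Rightarrow> bool) \<Rightarrow> ('a \<Rightarrow> 'a \<Rightarrow> bool) \<Rightarrow> 'a list \<Rightarrow> bool \<Rightarrow> bool \<Rightarrow> 'a list" where
  "marked X E vs e e' =
     concat (map (\<lambda>b. concat (map (\<lambda>c. concat (map (\<lambda>a. concat (map (\<lambda>d.
       concat (map (\<lambda>u. reduced_clique X E vs (clique_of X E vs u) b c a d)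
         (take 1 (filter (\<lambda>u. \<not> X u \<and> attached E (clique_of X E vs u) e b c \<and>
                               attached E (clique_of X E vs u) e' a d) vs))))
     (filter X vs))) (filter X vs))) (filter X vs))) (filter X vs))"

text \<open>Being a filter of \<open>vs\<close>, the kernel is free of duplicates and inherits the
  order of \<open>vs\<close>; the vertex count and \<open>encode_induced_pair\<close> depend on
  this.\<close>

definition kernel :: "('a \<Rightarrow> bool) \<Rightarrow> ('a \<Rightarrow> 'a \<Rightarrow> bool) \<Rightarrow> 'a list \<Rightarrow> 'a list" where
  "kernel X E vs = filter (\<lambda>v. X v \<or> v \<in> set (marked X E vs True True) \<or> v \<in> set (marked X E vs True False) \<or>
     v \<in> set (marked X E vs False True) \<or> v \<in> set (marked X E vs False False)) vs"

lemma reduced_clique_subset: "set (reduced_clique X E vs L b c a d) \<subseteq> set L"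
  unfolding reduced_clique_def by (auto dest!: in_set_takeD)

lemma ex_neq_in_take_2:
  assumes "distinct xs" "y \<in> set xs" "y \<noteq> w"
  shows "\<exists>y'\<in>set (take 2 xs). y' \<noteq> w"
proof (cases xs)
  case (Cons a ys)
  then show ?thesis using assms by (cases ys) auto
qed (use assms in simp)

lemma length_concat_map_le:
  "(\<And>x. x \<in> set xs \<Longrightarrow> length (f x) \<le> n) \<Longrightarrow> length (concat (map f xs)) \<le> length xs * n"
proof (induction xs)
  case (Cons x xs)
  then show ?case using Cons.prems[of x] by (simp add: add_mono)
qed simp

text \<open>
  A cut one of whose sides avoids \<open>X\<close> can be shrunk to one isolating \<open>Q - {w}\<close> for a clique \<open>Q\<close> of
  \<open>G - X\<close>, so if no such set has a stable neighbourhood, both sides meet \<open>X\<close>.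
\<close>

lemma cut_side_meets_modulator:
  assumes B: "B \<subseteq> U" "B \<noteq> {}" and AB: "A \<inter> B = {}"
    and no_edge: "\<And>a b. a \<in> A \<Longrightarrow> b \<in> B \<Longrightarrow> \<not> E a b \<and> \<not> E b a"
    and stable: "\<And>u v. u \<in> U - (A \<union> B) \<Longrightarrow> v \<in> U - (A \<union> B) \<Longrightarrow> \<not> E u v"
    and Q: "\<And>u. u \<in> U - X \<Longrightarrow> u \<in> Q u \<and> Q u \<subseteq> U - X"
    and Q_adj: "\<And>u y z. u \<in> U - X \<Longrightarrow> y \<in> Q u \<Longrightarrow> z \<in> Q u \<Longrightarrow> y \<noteq> z \<Longrightarrow> E y z"
    and Q_nbr: "\<And>u v y. u \<in> U - X \<Longrightarrow> y \<in> Q u \<Longrightarrow> v \<in> U - X \<Longrightarrow> E y v \<Longrightarrow> v \<in> Q u"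
    and unstable: "\<And>u D. u \<in> U - X \<Longrightarrow> D \<noteq> {} \<Longrightarrow> D = Q u \<or> (\<exists>w\<in>U. D = Q u - {w}) \<Longrightarrow>
       \<exists>x y d d'. x \<in> U - D \<and> y \<in> U - D \<and> d \<in> D \<and> d' \<in> D \<and> E d x \<and> E d' y \<and> E x y"
  shows "B \<inter> X \<noteq> {}"
proof
  assume BX: "B \<inter> X = {}"
  obtain u where u: "u \<in> B" using B by blast
  then have uU: "u \<in> U - X" using B BX by blast
  have QA: "Q u \<inter> A = {}"
  proof (rule ccontr)
    assume "Q u \<inter> A \<noteq> {}"
    then obtain a where "a \<in> Q u" "a \<in> A" by blast
    then show False using Q_adj[OF uU, of a u] Q[OF uU] no_edge[OF \<open>a \<in> A\<close> u] AB u by blast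
  qed
  \<comment> \<open>Since \<open>Q u\<close> misses \<open>A\<close>, its vertices outside
    \<open>B\<close> lie in the cutset, where two of them would be adjacent.\<close>
  have one: "Q u - B = {} \<or> (\<exists>w. Q u - B = {w})"
  proof (rule ccontr)
    assume "\<not> ?thesis"
    then obtain w w' where "w \<in> Q u - B" "w' \<in> Q u - B" "w \<noteq> w'" by blast
    then show False using Q_adj[OF uU, of w w'] stable[of w w'] Q[OF uU] QA by blast
  qed
  define D where "D = Q u \<inter> B"
  have "D \<noteq> {}" using u Q[OF uU] by (auto simp: D_def)
  moreover have "D = Q u \<or> (\<exists>w\<in>U. D = Q u - {w})"
    using one Q[OF uU] unfolding D_def by blast
  ultimately have "\<exists>x y d d'. x \<in> U - D \<and> y \<in> U - D \<and> d \<in> D \<and> d' \<in> D \<and> E d x \<and> E d' y \<and> E x y"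
    by (rule unstable[OF uU])
  then obtain x y d d' where xy: "x \<in> U - D" "y \<in> U - D" "d \<in> D" "d' \<in> D" "E d x" "E d' y" "E x y"
    by blast
  \<comment> \<open>Every neighbour of \<open>D\<close> outside \<open>D\<close> is in the cutset:
    it is not in \<open>A\<close>, as \<open>D\<close> lies in \<open>B\<close>, and a neighbour in
    \<open>B\<close> would avoid the modulator and hence belong to \<open>Q u\<close>. So
    \<open>x\<close> and \<open>y\<close> are adjacent cutset vertices.\<close>
  have "v \<in> U - (A \<union> B)" if v: "v \<in> U - D" "d \<in> D" "E d v" for v d
  proof -
    have "v \<notin> A" using no_edge[of v d] that(2,3) unfolding D_def by blast
    moreover have "v \<notin> B"
    proof
      assume "v \<in> B"
      then have "v \<in> U - X" using BX that by blast
      then have "v \<in> Q u" using Q_nbr[OF uU _ _ that(3)] that(2) unfolding D_def by blast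
      then show False using v \<open>v \<in> B\<close> unfolding D_def by blast
    qed
    ultimately show ?thesis using that by blast
  qed
  from this[OF xy(1,3,5)] this[OF xy(2,4,6)] show False using stable xy(7) by blast
qed

text \<open>All conditions are restricted to members of \<open>vs\<close>, because the adjacency
  decoded from a tree is meaningful only for numerals within range.\<close>

locale mod_cluster =
  fixes X :: "'a \<Rightarrow> bool" and E :: "'a \<Rightarrow> 'a \<Rightarrow> bool" and vs :: "'a list"
  assumes sym: "u \<in> set vs \<Longrightarrow> v \<in> set vs \<Longrightarrow> E u v \<Longrightarrow> E v u"
    and distinct: "distinct vs"
    and irrefl: "u \<in> set vs \<Longrightarrow> \<not> E u u"
    and cluster: "u \<in> set vs \<Longrightarrow> v \<in> set vs \<Longrightarrow> w \<in> set vs \<Longrightarrow> \<not> X u \<Longrightarrow> \<not> X v \<Longrightarrow> \<not> X w \<Longrightarrow>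
      E u v \<Longrightarrow> E v w \<Longrightarrow> u \<noteq> w \<Longrightarrow> E u w"
begin

abbreviation "V \<equiv> set vs"
abbreviation "K u \<equiv> set (clique_of X E vs u)"

lemma in_K: "v \<in> K u \<longleftrightarrow> v \<in> V \<and> \<not> X v \<and> (v = u \<or> E u v)"
  by (auto simp: clique_of_def)

lemma in_nbrs: "v \<in> set (nbrs E vs D) \<longleftrightarrow> v \<in> V \<and> v \<notin> set D \<and> (\<exists>d\<in>set D. E d v)"
  by (auto simp: nbrs_def)

lemma K_adjacent:
  assumes "u \<in> V" "\<not> X u" "y \<in> K u" "z \<in> K u" "y \<noteq> z"
  shows "E y z"
proof -
  have "y = u \<or> E y u" "z = u \<or> E u z" "y \<in> V" "z \<in> V" "\<not> X y" "\<not> X z"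
    using assms(1,3,4) sym unfolding in_K by blast+
  then show ?thesis using assms cluster by blast
qed

text \<open>Identifies \<open>K u\<close> as the component of \<open>u\<close> in
  \<open>G - X\<close>: it is the same for each of its members.\<close>

lemma K_eq:
  assumes "u \<in> V" "\<not> X u" "v \<in> K u"
  shows "K v = K u"
proof -
  have v: "v \<in> V" "\<not> X v" "u \<in> K v" using assms sym in_K by auto
  show ?thesis
  proof (intro set_eqI iffI)
    show "x \<in> K u" if "x \<in> K v" for x
      using K_adjacent[OF v(1,2,3) that] that assms unfolding in_K by auto
    show "x \<in> K v" if "x \<in> K u" for x
      using K_adjacent[OF assms that] that v unfolding in_K by auto
  qed
qed

section \<open>Correctness of the direct tests\<close>

lemma has_cut_of_separating_nbrs:
  assumes "set D \<subseteq> V" "separating_nbrs E vs D"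
  shows "has_cut V E"
proof (rule has_cutI[of "set D" _ "V - set D - set (nbrs E vs D)"])
  show "\<not> E a b" if "a \<in> set D" "b \<in> V - set D - set (nbrs E vs D)" for a b
    using that by (auto simp: in_nbrs)
  show "\<not> E u v" if "u \<in> V - (set D \<union> (V - set D - set (nbrs E vs D)))"
    "v \<in> V - (set D \<union> (V - set D - set (nbrs E vs D)))" for u v
    using that assms by (auto simp: separating_nbrs_def stable_nbrs_def)
qed (use assms in \<open>auto simp: separating_nbrs_def stable_nbrs_def\<close>)

lemma has_cut_easy_yes:
  assumes "easy_yes X E vs"
  shows "has_cut V E"
proof -
  obtain u w where "u \<in> V" "separating_nbrs E vs [u] \<or> separating_nbrs E vs (clique_of X E vs u) \<or>
      separating_nbrs E vs (filter (\<lambda>v. v \<noteq> w) (clique_of X E vs u))"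
    using assms unfolding easy_yes_def by blast
  moreover from this have "set [u] \<subseteq> V" "K u \<subseteq> V" "set (filter (\<lambda>v. v \<noteq> w) (clique_of X E vs u)) \<subseteq> V"
    by (auto simp: in_K)
  ultimately show ?thesis using has_cut_of_separating_nbrs by blast
qed

text \<open>The graph consists of the clique \<open>D\<close> and its stable neighbourhood.
  \<open>D\<close> misses one side \<open>C\<close> of any cut, so a vertex \<open>a\<close> of
  \<open>C\<close> has all its neighbours in \<open>D\<close>, and these lie in the cutset. Thus the
  neighbourhood of \<open>a\<close> alone is stable and separates \<open>a\<close> from the other
  side, contrary to the failure of \<open>easy_yes\<close>.\<close>

lemma no_cut_clique_plus_stable:
  assumes "\<not> easy_yes X E vs" and D: "\<And>y z. y \<in> set D \<Longrightarrow> z \<in> set D \<Longrightarrow> y \<noteq> z \<Longrightarrow> E y z"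
    and "set D \<subseteq> V" "stable_nbrs E vs D" "\<not> separating_nbrs E vs D"
  shows "\<not> has_cut V E"
proof
  assume "has_cut V E"
  then obtain A B where AB: "A \<subseteq> V" "B \<subseteq> V" "A \<noteq> {}" "B \<noteq> {}" "A \<inter> B = {}"
    "\<forall>a\<in>A. \<forall>b\<in>B. \<not> E a b" "\<forall>u\<in>V - (A \<union> B). \<forall>v\<in>V - (A \<union> B). \<not> E u v"
    unfolding has_cut_def by blast
  have V: "V = set D \<union> set (nbrs E vs D)"
    using assms(3-5) by (auto simp: separating_nbrs_def in_nbrs)
  have main: False if C: "C \<subseteq> V" "C' \<subseteq> V" "C \<noteq> {}" "C' \<noteq> {}" "C \<inter> C' = {}"
    "\<forall>a\<in>C. \<forall>b\<in>C'. \<not> E a b" "\<forall>u\<in>V - (C \<union> C'). \<forall>v\<in>V - (C \<union> C'). \<not> E u v" and D_C: "set D \<inter> C = {}" for C C'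
  proof -
    obtain a where a: "a \<in> C" "a \<in> set (nbrs E vs D)" using C V D_C by blast
    have nb: "v \<in> V - (C \<union> C')" if "v \<in> V" "E a v" for v
    proof -
      have "v \<notin> set (nbrs E vs D)"
        using assms(4) a that unfolding stable_nbrs_def by blast
      then have "v \<in> set D" using that V by blast
      then show ?thesis using C \<open>set D \<inter> C = {}\<close> a that by blast
    qed
    have "stable_nbrs E vs [a]"
      unfolding stable_nbrs_def using nb C(7) by (auto simp: in_nbrs)
    moreover obtain b where "b \<in> C'" using C by blast
    then have "b \<in> V \<and> b \<noteq> a \<and> b \<notin> set (nbrs E vs [a])"
      using C a by (auto simp: in_nbrs)
    ultimately have "separating_nbrs E vs [a]"
      unfolding separating_nbrs_def by auto
    then show False using assms(1) a C unfolding easy_yes_def by blast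
  qed
  have "set D \<inter> A = {} \<or> set D \<inter> B = {}"
    using D AB by blast
  moreover have "\<forall>b\<in>B. \<forall>a\<in>A. \<not> E b a"
    using AB(1,2,6) sym by blast
  moreover have "B \<inter> A = {}" "\<forall>u\<in>V - (B \<union> A). \<forall>v\<in>V - (B \<union> A). \<not> E u v"
    using AB(5,7) by (simp_all add: Un_commute Int_commute)
  ultimately show False
    using main[OF AB] main[OF AB(2,1,4,3)] by blast
qed

lemma no_cut_easy_no:
  assumes "\<not> easy_yes X E vs" "easy_no X E vs"
  shows "\<not> has_cut V E"
proof -
  obtain u D where u: "u \<in> V" "\<not> X u" and D: "set D \<subseteq> K u" "stable_nbrs E vs D" "\<not> separating_nbrs E vs D"
  proof -
    obtain u where u: "u \<in> V" "\<not> X u" and "stable_nbrs E vs (clique_of X E vs u) \<or>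
        (\<exists>w\<in>V. stable_nbrs E vs (filter (\<lambda>v. v \<noteq> w) (clique_of X E vs u)))"
      using assms(2) unfolding easy_no_def by blast
    then obtain D where "stable_nbrs E vs D"
      and D: "D = clique_of X E vs u \<or> (\<exists>w\<in>V. D = filter (\<lambda>v. v \<noteq> w) (clique_of X E vs u))" by blast
    moreover have "\<not> separating_nbrs E vs D"
      using assms(1) u D unfolding easy_yes_def by blast
    moreover have "set D \<subseteq> K u" using D by auto
    ultimately show ?thesis using that u by blast
  qed
  have "E y z" if "y \<in> set D" "z \<in> set D" "y \<noteq> z" for y z
    using K_adjacent[OF u] D that by blast
  then show ?thesis
    using no_cut_clique_plus_stable assms(1) D in_K by blast
qed

text \<open>Turns the failure of \<open>easy_no\<close> into the hypothesis \<open>unstable\<close>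
  of \<open>cut_side_meets_modulator\<close>.\<close>

lemma unstable_nbrs:
  assumes "\<not> easy_no X E vs" "u \<in> V" "\<not> X u" "D \<noteq> {}" "D = K u \<or> (\<exists>w\<in>V. D = K u - {w})"
  shows "\<exists>x y d d'. x \<in> V - D \<and> y \<in> V - D \<and> d \<in> D \<and> d' \<in> D \<and> E d x \<and> E d' y \<and> E x y"
proof -
  obtain L where "D = set L" "\<not> stable_nbrs E vs L"
  proof (cases "D = K u")
    case True
    then show ?thesis using that[of "clique_of X E vs u"] assms unfolding easy_no_def by blast
  next
    case False
    then obtain w where "w \<in> V" "D = K u - {w}" using assms by blast
    then show ?thesis
      using that[of "filter (\<lambda>v. v \<noteq> w) (clique_of X E vs u)"] assms(1-3) unfolding easy_no_def by auto
  qed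
  then obtain x y where "x \<in> set (nbrs E vs L)" "y \<in> set (nbrs E vs L)" "E x y"
    using assms(4) unfolding stable_nbrs_def by auto
  then show ?thesis
    using \<open>D = set L\<close> unfolding in_nbrs by blast
qed

lemma cut_meets_modulator:
  assumes "\<not> easy_no X E vs" "A \<subseteq> V" "B \<subseteq> V" "B \<noteq> {}" "A \<inter> B = {}"
    "\<forall>a\<in>A. \<forall>b\<in>B. \<not> E a b" "\<forall>u\<in>V - (A \<union> B). \<forall>v\<in>V - (A \<union> B). \<not> E u v"
  shows "\<exists>b\<in>B. X b"
proof -
  have "B \<inter> Collect X \<noteq> {}"
  proof (rule cut_side_meets_modulator[where U = V and Q = K and A = A and E = E])
    show "\<not> E a b \<and> \<not> E b a" if "a \<in> A" "b \<in> B" for a b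
      using that assms(2,3,6) sym by blast
    show "E y z" if "u \<in> V - Collect X" "y \<in> K u" "z \<in> K u" "y \<noteq> z" for u y z
      using that by (blast intro: K_adjacent)
    show "v \<in> K u" if "u \<in> V - Collect X" "y \<in> K u" "v \<in> V - Collect X" "E y v" for u v y
    proof -
      have "v \<in> K y" using that by (simp add: in_K)
      then show ?thesis using K_eq[of u y] that by simp
    qed
    show "\<exists>x y d d'. x \<in> V - D \<and> y \<in> V - D \<and> d \<in> D \<and> d' \<in> D \<and> E d x \<and> E d' y \<and> E x y"
      if "u \<in> V - Collect X" "D \<noteq> {}" "D = K u \<or> (\<exists>w\<in>V. D = K u - {w})" for u D
      by (rule unstable_nbrs[OF assms(1) _ _ that(2,3)]) (use that(1) in auto)
    show "u \<in> K u \<and> K u \<subseteq> V - Collect X" if "u \<in> V - Collect X" for u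
      using that by (auto simp: in_K)
  qed (use assms in auto)
  then show ?thesis by blast
qed

section \<open>What the kernel preserves of the cliques\<close>

abbreviation "W \<equiv> set (kernel X E vs)"

lemma in_W: "v \<in> W \<longleftrightarrow> v \<in> V \<and> (X v \<or> (\<exists>e e'. v \<in> set (marked X E vs e e')))"
  by (auto simp: kernel_def ex_bool_eq)

definition selected :: "bool \<Rightarrow> bool \<Rightarrow> 'a \<Rightarrow> 'a \<Rightarrow> 'a \<Rightarrow> 'a \<Rightarrow> 'a \<Rightarrow> bool" where
  "selected e e' b c a d u \<longleftrightarrow> u \<in> set (take 1 (filter (\<lambda>u. \<not> X u \<and> attached E (clique_of X E vs u) e b c \<and>
     attached E (clique_of X E vs u) e' a d) vs))"

lemma selectedD:
  assumes "selected e e' b c a d u"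
  shows "u \<in> V" "\<not> X u" "attached E (clique_of X E vs u) e b c" "attached E (clique_of X E vs u) e' a d"
  using in_set_takeD[OF assms[unfolded selected_def]] by auto

lemma ex_selected:
  assumes "u \<in> V" "\<not> X u" "attached E (clique_of X E vs u) e b c" "attached E (clique_of X E vs u) e' a d"
  shows "\<exists>u'. selected e e' b c a d u'"
proof -
  let ?l = "filter (\<lambda>u. \<not> X u \<and> attached E (clique_of X E vs u) e b c \<and>
     attached E (clique_of X E vs u) e' a d) vs"
  have "u \<in> set ?l" using assms by simp
  then obtain u' l' where "?l = u' # l'" by (cases ?l) auto
  then show ?thesis unfolding selected_def by (intro exI[of _ u']) simp
qed

lemma in_marked: "v \<in> set (marked X E vs e e') \<longleftrightarrow> (\<exists>b c a d u. b \<in> V \<and> X b \<and> c \<in> V \<and> X c \<and> a \<in> V \<and> X a \<and>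
   d \<in> V \<and> X d \<and> selected e e' b c a d u \<and> v \<in> set (reduced_clique X E vs (clique_of X E vs u) b c a d))"
  unfolding marked_def selected_def by (auto; blast)

lemma reduced_clique_nbr:
  assumes "u \<in> V" "\<not> X u" "set (reduced_clique X E vs (clique_of X E vs u) b c a d) \<subseteq> W"
    and "x \<in> V" "X x" "y \<in> K u" "y \<noteq> w" "E y x"
  shows "\<exists>y'\<in>K u \<inter> W. y' \<noteq> w \<and> E y' x"
proof -
  let ?l = "filter (\<lambda>y. E y x) (clique_of X E vs u)"
  have "distinct ?l" using distinct by (simp add: clique_of_def)
  then obtain y' where y': "y' \<in> set (take 2 ?l)" "y' \<noteq> w"
    using ex_neq_in_take_2[of ?l y w] assms by auto
  then have "y' \<in> set (reduced_clique X E vs (clique_of X E vs u) b c a d)"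
    using assms by (auto simp: reduced_clique_def)
  moreover have "y' \<in> set ?l" using y' by (blast dest: in_set_takeD)
  ultimately show ?thesis using assms(3) y' by auto
qed

lemma reduced_clique_subset_W:
  assumes "selected e e' b c a d u" "b \<in> V" "X b" "c \<in> V" "X c" "a \<in> V" "X a" "d \<in> V" "X d"
  shows "set (reduced_clique X E vs (clique_of X E vs u) b c a d) \<subseteq> W"
proof
  fix v assume v: "v \<in> set (reduced_clique X E vs (clique_of X E vs u) b c a d)"
  then have "v \<in> set (marked X E vs e e')"
    unfolding in_marked using assms by blast
  moreover have "v \<in> V" using subsetD[OF reduced_clique_subset v] by (simp add: in_K)
  ultimately show "v \<in> W" unfolding in_W by blast
qed

text \<open>A kernel vertex outside the modulator was marked through some selected clique, which is
  its own clique; so the guarantee of \<open>reduced_clique_nbr\<close> applies to it.\<close>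

lemma W_nbr:
  assumes "v \<in> W" "\<not> X v" "x \<in> V" "X x" "y \<in> K v" "y \<noteq> w" "E y x"
  shows "\<exists>y'\<in>K v \<inter> W. y' \<noteq> w \<and> E y' x"
proof -
  obtain e e' b c a d u where *: "b \<in> V" "X b" "c \<in> V" "X c" "a \<in> V" "X a" "d \<in> V" "X d"
    and u: "selected e e' b c a d u" "v \<in> set (reduced_clique X E vs (clique_of X E vs u) b c a d)"
    using assms(1,2) unfolding in_W in_marked by blast
  have "v \<in> K u" by (rule subsetD[OF reduced_clique_subset u(2)])
  then have "K v = K u" using K_eq selectedD(1,2)[OF u(1)] by blast
  then show ?thesis
    using reduced_clique_nbr[OF selectedD(1,2)[OF u(1)] reduced_clique_subset_W[OF u(1) *]] assms(3-) by simp
qed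

lemma attached_W:
  assumes u: "u \<in> V" "\<not> X u" and sub: "set (reduced_clique X E vs (clique_of X E vs u) b c a d) \<subseteq> W"
    and bc: "b' \<in> V" "X b'" "c' \<in> V" "X c'" and att: "attached E (clique_of X E vs u) e b' c'"
    and "b' = b \<and> c' = c \<or> b' = a \<and> c' = d"
  shows "\<exists>y\<in>K u \<inter> W. \<exists>z\<in>K u \<inter> W. E y b' \<and> E z c' \<and> (y = z \<longleftrightarrow> e)"
proof -
  obtain y z where yz: "y \<in> K u" "z \<in> K u" "E y b'" "E z c'" "y = z \<longleftrightarrow> e"
    using att unfolding attached_def by blast
  show ?thesis
  proof (cases e)
    case True
    let ?l = "filter (\<lambda>y. E y b' \<and> E y c') (clique_of X E vs u)"
    have "y \<in> set ?l" using yz True by simp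
    then obtain y' l' where l: "?l = y' # l'" by (cases ?l) auto
    then have "y' \<in> set ?l" by simp
    moreover from l have "y' \<in> set (take 1 ?l)" by simp
    then have "y' \<in> W" using sub assms(9) unfolding reduced_clique_def by auto
    ultimately show ?thesis using True by auto
  next
    case False
    \<comment> \<open>Two exchanges: first \<open>z\<close> is replaced by a kept \<open>z'\<close>
      different from \<open>y\<close>, then \<open>y\<close> by a kept \<open>y'\<close> different
      from \<open>z'\<close>. The original \<open>y\<close> need not be kept.\<close>
    obtain z' where z': "z' \<in> K u \<inter> W" "z' \<noteq> y" "E z' c'"
      using reduced_clique_nbr[OF u sub bc(3,4), of z y] yz False by blast
    moreover obtain y' where "y' \<in> K u \<inter> W" "y' \<noteq> z'" "E y' b'"
      using reduced_clique_nbr[OF u sub bc(1,2), of y z'] yz z' by blast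
    ultimately show ?thesis using False by blast
  qed
qed

text \<open>Restricting a cut to \<open>W\<close> can only fail by emptying a side. Both sides meet
  the modulator, which is contained in \<open>W\<close>.\<close>

lemma has_cut_kernel:
  assumes "\<not> easy_no X E vs" "has_cut V E"
  shows "has_cut W E"
proof -
  obtain A B where AB: "A \<subseteq> V" "B \<subseteq> V" "A \<noteq> {}" "B \<noteq> {}" "A \<inter> B = {}"
    "\<forall>a\<in>A. \<forall>b\<in>B. \<not> E a b" "\<forall>u\<in>V - (A \<union> B). \<forall>v\<in>V - (A \<union> B). \<not> E u v"
    using assms(2) unfolding has_cut_def by blast
  have "\<forall>b\<in>B. \<forall>a\<in>A. \<not> E b a" using AB(1,2,6) sym by blast
  then obtain a where "a \<in> A" "X a"
    using cut_meets_modulator[OF assms(1), of B A] AB by (auto simp: Un_commute Int_commute)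
  moreover obtain b where "b \<in> B" "X b"
    using cut_meets_modulator[OF assms(1), of A B] AB by auto
  ultimately have "A \<inter> W \<noteq> {}" "B \<inter> W \<noteq> {}"
    using AB(1,2) in_W by blast+
  then show ?thesis
    using AB(5,6,7) in_W by (intro has_cutI[of "A \<inter> W" _ "B \<inter> W"]) auto
qed

text \<open>The shrinking argument inside \<open>W\<close>, with cliques
  \<open>K u \<inter> W\<close>. Instability is inherited from the whole graph: each
  \<open>D\<close> is \<open>D' \<inter> W\<close> for a set \<open>D'\<close> of the same form, and
  the adjacent neighbours \<open>x\<close>, \<open>y\<close> of \<open>D'\<close> turn out to be
  neighbours of \<open>D\<close> in \<open>W\<close>.\<close>

lemma cut_kernel_meets_modulator:
  assumes "\<not> easy_no X E vs" "A \<subseteq> W" "B \<subseteq> W" "B \<noteq> {}" "A \<inter> B = {}"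
    "\<forall>a\<in>A. \<forall>b\<in>B. \<not> E a b" "\<forall>u\<in>W - (A \<union> B). \<forall>v\<in>W - (A \<union> B). \<not> E u v"
  shows "\<exists>b\<in>B. X b"
proof -
  have W_V: "v \<in> V" if "v \<in> W" for v using that in_W by blast
  have "B \<inter> Collect X \<noteq> {}"
  proof (rule cut_side_meets_modulator[where U = W and Q = "\<lambda>u. K u \<inter> W" and A = A and E = E])
    show "\<not> E a b \<and> \<not> E b a" if "a \<in> A" "b \<in> B" for a b
      using that assms(2,3,6) sym W_V by blast
    show "E y z" if "u \<in> W - Collect X" "y \<in> K u \<inter> W" "z \<in> K u \<inter> W" "y \<noteq> z" for u y z
      using that W_V by (blast intro: K_adjacent)
    show "v \<in> K u \<inter> W" if "u \<in> W - Collect X" "y \<in> K u \<inter> W" "v \<in> W - Collect X" "E y v" for u v y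
    proof -
      have "v \<in> K y" using that W_V by (simp add: in_K)
      then show ?thesis using K_eq[of u y] that W_V by simp
    qed
    show "u \<in> K u \<inter> W \<and> K u \<inter> W \<subseteq> W - Collect X" if "u \<in> W - Collect X" for u
      using that W_V by (auto simp: in_K)
    show "\<exists>x y d d'. x \<in> W - D \<and> y \<in> W - D \<and> d \<in> D \<and> d' \<in> D \<and> E d x \<and> E d' y \<and> E x y"
      if u: "u \<in> W - Collect X" and D: "D \<noteq> {}" "D = K u \<inter> W \<or> (\<exists>w\<in>W. D = K u \<inter> W - {w})" for u D
    proof -
      obtain D' where D': "D' = K u \<or> (\<exists>w\<in>W. D' = K u - {w})" "D = D' \<inter> W"
        using D(2) by blast
      have uV: "u \<in> V" "\<not> X u" using u W_V by auto
      have "\<exists>x y d d'. x \<in> V - D' \<and> y \<in> V - D' \<and> d \<in> D' \<and> d' \<in> D' \<and> E d x \<and> E d' y \<and> E x y"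
        using unstable_nbrs[OF assms(1) uV, of D'] D' D(1) W_V by blast
      then obtain x y d d' where xy: "x \<in> V - D'" "y \<in> V - D'" "d \<in> D'" "d' \<in> D'" "E d x" "E d' y" "E x y"
        by blast
      have D'_nbr: "v \<in> W - D \<and> (\<exists>d\<in>D. E d v)" if vd: "v \<in> V - D'" "d \<in> D'" "E d v" for v d
      proof (cases "X v")
        case True
        have "d \<in> K u" using D' vd by blast
        \<comment> \<open>If \<open>D' = K u\<close>, the modulator vertex \<open>v\<close>, which
          is not in \<open>K u\<close>, can serve as \<open>w\<close>.\<close>
        obtain w where w: "D' = K u - {w}" using D' uV by (cases "D' = K u") (use True in_K in auto)
        obtain d' where "d' \<in> K u \<inter> W" "d' \<noteq> w" "E d' v"
          using W_nbr[of u v d w] u True vd w by blast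
        then show ?thesis using vd w D' in_W True by blast
      next
        case False
        \<comment> \<open>A neighbour \<open>v\<close> outside the modulator lies in the clique
          itself, so it is the removed vertex \<open>w\<close>, which was taken from
          \<open>W\<close> and is adjacent to all of \<open>D\<close>.\<close>
        have "d \<in> K u" using D'(1) vd(2) by blast
        then have "v \<in> K u" using vd False K_eq[OF uV, of d] in_K[of v d] by blast
        then obtain w where w: "w \<in> W" "D' = K u - {w}" using D' vd by blast
        then have "v = w" using \<open>v \<in> K u\<close> vd by blast
        obtain d' where "d' \<in> D" using D(1) \<open>D \<noteq> {}\<close> by blast
        then have "E d' v"
          using K_adjacent[OF uV, of d' v] \<open>v \<in> K u\<close> w D' \<open>v = w\<close> by blast
        then show ?thesis using w \<open>v = w\<close> \<open>d' \<in> D\<close> D' by blast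
      qed
      show ?thesis
        using D'_nbr[OF xy(1,3,5)] D'_nbr[OF xy(2,4,6)] xy(7) by blast
    qed
  qed (use assms in auto)
  then show ?thesis by blast
qed

text \<open>Only the colouring of the modulator is kept. Each clique of the whole graph is assigned
  to one side, except that vertices with a modulator neighbour on the other side join the cutset.
  This works for a side unless the clique is blocked by the opposite one, and the marking ensures
  that no clique is blocked by both.\<close>

lemma has_cut_of_kernel:
  assumes "\<not> easy_no X E vs" "has_cut W E"
  shows "has_cut V E"
proof -
  obtain A B where AB: "A \<subseteq> W" "B \<subseteq> W" "A \<noteq> {}" "B \<noteq> {}" "A \<inter> B = {}"
    "\<forall>a\<in>A. \<forall>b\<in>B. \<not> E a b" "\<forall>u\<in>W - (A \<union> B). \<forall>v\<in>W - (A \<union> B). \<not> E u v"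
    using assms(2) unfolding has_cut_def by blast
  have W_V: "v \<in> V" if "v \<in> W" for v using that in_W by blast
  have X_W: "v \<in> W" if "v \<in> V" "X v" for v using that in_W by blast
  have BA: "\<forall>b\<in>B. \<forall>a\<in>A. \<not> E b a" using AB(1,2,6) sym W_V by blast
  obtain a0 where a0: "a0 \<in> A" "X a0"
    using cut_kernel_meets_modulator[OF assms(1), of B A] AB BA by (auto simp: Un_commute Int_commute)
  obtain b0 where b0: "b0 \<in> B" "X b0"
    using cut_kernel_meets_modulator[OF assms(1), of A B] AB by auto
  \<comment> \<open>\<open>blocked P u\<close>: the clique of \<open>u\<close> cannot lie on the side opposite to \<open>P\<close>, up to one cutset vertex.\<close>
  define blocked where "blocked P u \<longleftrightarrow> (\<exists>y\<in>K u. \<exists>z\<in>K u. \<exists>b\<in>P. \<exists>c\<in>W. X b \<and> X c \<and> E y b \<and> E z c \<and>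
      (if y = z then c \<notin> A \<and> c \<notin> B else c \<in> P))" for P u
  have blocked_cong: "blocked P v \<longleftrightarrow> blocked P u" if "u \<in> V" "\<not> X u" "v \<in> K u" for P u v
    unfolding blocked_def K_eq[OF that] ..
  \<comment> \<open>A clique blocked by both sides yields a quadruple \<open>b\<close>,
    \<open>c\<close>, \<open>a\<close>, \<open>d\<close>, for which some clique was selected. The
    witnesses kept of that clique force it to meet both \<open>A\<close> and \<open>B\<close> within
    \<open>W\<close>, although its vertices are pairwise adjacent.\<close>
  have not_both: "\<not> (blocked A u \<and> blocked B u)" if u: "u \<in> V" "\<not> X u" for u
  proof
    assume "blocked A u \<and> blocked B u"
    then obtain y z b c y' z' a d where
      1: "y \<in> K u" "z \<in> K u" "b \<in> B" "c \<in> W" "X b" "X c" "E y b" "E z c"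
        "if y = z then c \<notin> A \<and> c \<notin> B else c \<in> B" and
      2: "y' \<in> K u" "z' \<in> K u" "a \<in> A" "d \<in> W" "X a" "X d" "E y' a" "E z' d"
        "if y' = z' then d \<notin> A \<and> d \<notin> B else d \<in> A"
      unfolding blocked_def by blast
    have V: "b \<in> V" "c \<in> V" "a \<in> V" "d \<in> V" using 1 2 AB W_V by blast+
    have "attached E (clique_of X E vs u) (y = z) b c" "attached E (clique_of X E vs u) (y' = z') a d"
      unfolding attached_def using 1 2 by blast+
    then obtain u' where u': "selected (y = z) (y' = z') b c a d u'"
      using ex_selected[OF u] by blast
    note uV = selectedD(1,2)[OF u']
    have sub: "set (reduced_clique X E vs (clique_of X E vs u') b c a d) \<subseteq> W"
      using reduced_clique_subset_W[OF u'] V 1 2 by blast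
    obtain y1 z1 where y1: "y1 \<in> K u' \<inter> W" "z1 \<in> K u' \<inter> W" "E y1 b" "E z1 c" "y1 = z1 \<longleftrightarrow> y = z"
      using attached_W[OF uV sub V(1) 1(5) V(2) 1(6) selectedD(3)[OF u']] by blast
    obtain y2 z2 where y2: "y2 \<in> K u' \<inter> W" "z2 \<in> K u' \<inter> W" "E y2 a" "E z2 d" "y2 = z2 \<longleftrightarrow> y' = z'"
      using attached_W[OF uV sub V(3) 2(5) V(4) 2(6) selectedD(4)[OF u']] by blast
    \<comment> \<open>The edges to \<open>b\<close> and \<open>c\<close> keep the witnesses out of
      \<open>P'\<close>. If they also avoided \<open>P\<close>, they would be adjacent cutset
      vertices or, when equal, one cutset vertex adjacent to the cutset vertex
      \<open>c\<close>.\<close>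
    have forced: "y1 \<in> P \<or> z1 \<in> P"
      if P: "P = A \<and> P' = B \<or> P = B \<and> P' = A" and "b \<in> P" "c \<in> W" "y1 \<in> K u' \<inter> W" "z1 \<in> K u' \<inter> W" "E y1 b" "E z1 c"
        "if y1 = z1 then c \<notin> A \<and> c \<notin> B else c \<in> P" for P P' y1 z1 b c
    proof (rule ccontr)
      assume contr: "\<not> ?thesis"
      have no_edge: "\<not> E p q" if "p \<in> P'" "q \<in> P" for p q using P that AB(6) BA by blast
      have "y1 \<notin> P'" using no_edge that by blast
      show False
      proof (cases "y1 = z1")
        case True
        then show False using that contr \<open>y1 \<notin> P'\<close> AB(7) by (auto split: if_splits)
      next
        case False
        then have "z1 \<notin> P'" using no_edge that by auto
        moreover have "E y1 z1" using False K_adjacent[OF uV] that by blast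
        ultimately show False using that contr \<open>y1 \<notin> P'\<close> AB(7) by auto
      qed
    qed
    have "y1 \<in> B \<or> z1 \<in> B"
      by (rule forced[of B A b c]) (use 1 y1 in auto)
    moreover have "y2 \<in> A \<or> z2 \<in> A"
      by (rule forced[of A B a d]) (use 2 y2 in auto)
    ultimately obtain p q where "p \<in> A" "q \<in> B" "p \<in> K u'" "q \<in> K u'" using y1 y2 by blast
    then show False using K_adjacent[OF uV, of p q] AB by blast
  qed
  \<comment> \<open>Cliques blocked by \<open>B\<close> go to the side of \<open>B\<close>, all
    others to that of \<open>A\<close>.\<close>
  define A' where "A' = {v \<in> V. if X v then v \<in> A else \<not> blocked B v \<and> \<not> (\<exists>b\<in>B. X b \<and> E v b)}"
  define B' where "B' = {v \<in> V. if X v then v \<in> B else blocked B v \<and> \<not> (\<exists>a\<in>A. X a \<and> E v a)}"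
  show ?thesis
  proof (rule has_cutI[of A' _ B'])
    show "A' \<noteq> {}" using a0 AB(1) W_V unfolding A'_def by auto
    show "B' \<noteq> {}" using b0 AB(2) W_V unfolding B'_def by auto
    show "A' \<inter> B' = {}" using AB(5) unfolding A'_def B'_def by (auto split: if_splits)
    show "\<not> E a b" if ab: "a \<in> A'" "b \<in> B'" for a b
    proof
      assume "E a b"
      have V: "a \<in> V" "b \<in> V" using ab unfolding A'_def B'_def by auto
      then have "E b a" using \<open>E a b\<close> sym by blast
      consider "X a" "X b" | "X a" "\<not> X b" | "\<not> X a" "X b" | "\<not> X a" "\<not> X b" by blast
      then show False
      proof cases
        case 4
        then have "b \<in> K a" using V \<open>E a b\<close> by (simp add: in_K)
        then have "blocked B b \<longleftrightarrow> blocked B a" using blocked_cong V 4 by blast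
        then show False using ab 4 unfolding A'_def B'_def by auto
      qed (use ab \<open>E a b\<close> \<open>E b a\<close> AB(6) in \<open>auto simp: A'_def B'_def\<close>)
    qed
    have blockedI: "blocked P u" if "y \<in> K u" "z \<in> K u" "b \<in> P" "c \<in> W" "X b" "X c" "E y b" "E z c"
      "if y = z then c \<notin> A \<and> c \<notin> B else c \<in> P" for P u y z b c
      unfolding blocked_def using that by blast
    \<comment> \<open>\<open>P\<close> is the side opposite to the one assigned to the clique of
      \<open>v\<close>. The last equivalence makes \<open>P\<close> depend on the clique only, so
      two adjacent new cutset vertices outside the modulator have the same \<open>P\<close> and
      would block their clique.\<close>
    have rest: "\<exists>P b. (P = A \<or> P = B) \<and> \<not> blocked P v \<and> b \<in> P \<and> X b \<and> E v b \<and> (P = A \<longleftrightarrow> blocked B v)"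
      if v: "v \<in> V - (A' \<union> B')" "\<not> X v" for v
    proof (cases "blocked B v")
      case True
      then have "\<not> blocked A v" using not_both v by blast
      moreover obtain a where "a \<in> A" "X a" "E v a" using v True unfolding B'_def by auto
      ultimately show ?thesis using True by blast
    next
      case False
      moreover obtain b where "b \<in> B" "X b" "E v b" using v False unfolding A'_def by auto
      moreover have "B \<noteq> A" using AB by blast
      ultimately show ?thesis by blast
    qed
    have mixed: "\<not> E v x" if v: "v \<in> V - (A' \<union> B')" "\<not> X v" and x: "x \<in> V - (A' \<union> B')" "X x" for v x
    proof
      assume "E v x"
      obtain P b where P: "\<not> blocked P v" "b \<in> P" "X b" "E v b" using rest[OF v] by blast
      have "x \<in> W" "x \<notin> A" "x \<notin> B" using x X_W unfolding A'_def B'_def by auto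
      moreover have "v \<in> K v" using v by (simp add: in_K)
      ultimately show False using blockedI[of v v v b P x] P x \<open>E v x\<close> by auto
    qed
    show "\<not> E u v" if uv: "u \<in> V - (A' \<union> B')" "v \<in> V - (A' \<union> B')" for u v
    proof
      assume "E u v"
      have V: "u \<in> V" "v \<in> V" using uv by auto
      then have "E v u" using \<open>E u v\<close> sym by blast
      consider "X u" "X v" | "X u" "\<not> X v" | "\<not> X u" "X v" | "\<not> X u" "\<not> X v" by blast
      then show False
      proof cases
        case 1
        then have "u \<in> W - (A \<union> B)" "v \<in> W - (A \<union> B)"
          using uv X_W unfolding A'_def B'_def by auto
        then show False using AB(7) \<open>E u v\<close> by blast
      next
        case 2
        then show False using mixed uv \<open>E v u\<close> by blast
      next
        case 3
        then show False using mixed uv \<open>E u v\<close> by blast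
      next
        case 4
        then have K: "v \<in> K u" "u \<in> K u" using V \<open>E u v\<close> by (auto simp: in_K)
        then have cong: "blocked P v \<longleftrightarrow> blocked P u" for P using blocked_cong V 4 by blast
        obtain P b where P: "P = A \<or> P = B" "\<not> blocked P u" "b \<in> P" "X b" "E u b" "P = A \<longleftrightarrow> blocked B u"
          using rest[OF uv(1) 4(1)] by blast
        obtain P' c where P': "P' = A \<or> P' = B" "c \<in> P'" "X c" "E v c" "P' = A \<longleftrightarrow> blocked B v"
          using rest[OF uv(2) 4(2)] by blast
        have "P' = P" using P(1,6) P'(1,5) cong by blast
        moreover have "u \<noteq> v" using \<open>E u v\<close> irrefl V by blast
        moreover have "c \<in> W" using P' AB(1,2) by blast
        ultimately show False using blockedI[of u u v b P c] P P' K by auto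
      qed
    qed
  qed (auto simp: A'_def B'_def)
qed

section \<open>Size of the kernel\<close>

lemma length_marked: "length (marked X E vs e e') \<le> length (filter X vs) ^ 4 * (2 + 2 * length (filter X vs))"
proof -
  let ?k = "length (filter X vs)"
  have "length (reduced_clique X E vs L b c a d) \<le> 1 + (1 + ?k * 2)" for L b c a d
    unfolding reduced_clique_def length_append by (intro add_mono length_concat_map_le) auto
  then have "length (marked X E vs e e') \<le> ?k * (?k * (?k * (?k * (1 * (1 + (1 + ?k * 2))))))"
    unfolding marked_def
    by (intro length_concat_map_le order_trans[OF length_concat_map_le mult_le_mono1]) auto
  then show ?thesis by (simp add: power4_eq_xxxx algebra_simps)
qed

text \<open>With \<open>m = max 1 k\<close> for \<open>k\<close> modulator vertices, the modulator
  contributes at most \<open>m ^ 5\<close>, and each of the four flag pairs at most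
  \<open>m ^ 4\<close> cliques of at most \<open>4 * m\<close> kept vertices; hence
  \<open>17 = 1 + 4 * 4\<close>.\<close>

lemma length_kernel: "length (kernel X E vs) \<le> 17 * max 1 (card (V \<inter> Collect X)) ^ 5"
proof -
  let ?k = "length (filter X vs)"
  let ?m = "max 1 ?k"
  let ?M = "marked X E vs"
  have poly_eq: "m ^ 5 + 4 * (m ^ 4 * (4 * m)) = 17 * m ^ 5" for m :: nat
    by (simp add: eval_nat_numeral algebra_simps)
  have "distinct (kernel X E vs)" using distinct by (simp add: kernel_def)
  then have "length (kernel X E vs) = card W" by (simp add: distinct_card)
  also have "\<dots> \<le> card (set (filter X vs @ ?M True True @ ?M True False @ ?M False True @ ?M False False))"
    by (intro card_mono) (auto simp: kernel_def)
  also have "\<dots> \<le> length (filter X vs @ ?M True True @ ?M True False @ ?M False True @ ?M False False)"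
    by (rule card_length)
  also have "\<dots> \<le> ?k + 4 * (?k ^ 4 * (2 + 2 * ?k))"
    using length_marked[of True True] length_marked[of True False] length_marked[of False True]
      length_marked[of False False] by simp
  also have "\<dots> \<le> ?m ^ 5 + 4 * (?m ^ 4 * (4 * ?m))"
    using power_increasing[of 1 5 ?m] by (intro add_mono mult_le_mono power_mono) auto
  also have "\<dots> = 17 * ?m ^ 5" by (rule poly_eq)
  also have "?k = card (V \<inter> Collect X)"
    using distinct by (simp add: distinct_card[symmetric] Int_def)
  finally show ?thesis .
qed

end

section \<open>Stable cutsets and cluster graphs in terms of adjacency\<close>

lemma (in graph) graph_induce:
  assumes "S \<subseteq> verts G"
  shows "graph (G \<restriction> S)"
proof -
  have "induced_subgraph (G \<restriction> S) G" using assms by (rule induced_induce)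
  then interpret H: sym_digraph "G \<restriction> S" by (rule induced_graph_imp_graph)
  show ?thesis
  proof
    show "finite (verts (G \<restriction> S))" using finite_subset[OF assms finite_verts] by simp
    show "tail (G \<restriction> S) e \<noteq> head (G \<restriction> S) e" if "e \<in> arcs (G \<restriction> S)" for e
      using that no_loops by simp
    show "e1 = e2" if "e1 \<in> arcs (G \<restriction> S)" "e2 \<in> arcs (G \<restriction> S)"
      "arc_to_ends (G \<restriction> S) e1 = arc_to_ends (G \<restriction> S) e2" for e1 e2
      using that no_multi_arcs by simp
  qed simp
qed

lemma arcs_ends_induce: "arcs_ends (G \<restriction> S) = arcs_ends G \<inter> S \<times> S"
  by (auto simp: arcs_ends_conv)

text \<open>One direction splits off a single component, which no arc leaves because arcs are
  symmetric. Conversely, \<open>A\<close> is closed under reachability, so vertices of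
  \<open>A\<close> and \<open>B\<close> have different components.\<close>

lemma (in graph) disconnected_graph_iff:
  "disconnected_graph G \<longleftrightarrow> (\<exists>A B. A \<noteq> {} \<and> B \<noteq> {} \<and> A \<inter> B = {} \<and> A \<union> B = verts G \<and>
     (\<forall>a\<in>A. \<forall>b\<in>B. (a, b) \<notin> arcs_ends G))"
proof -
  have card: "disconnected_graph G \<longleftrightarrow> card (scc_of ` verts G) \<ge> 2"
    unfolding disconnected_graph_def by (simp add: card_sccs_verts[symmetric] sccs_verts_conv_scc_of)
  show ?thesis
  proof
    assume "disconnected_graph G"
    then have "\<not> card (scc_of ` verts G) \<le> Suc 0" using card by simp
    then obtain u v where uv: "u \<in> verts G" "v \<in> verts G" "scc_of u \<noteq> scc_of v"
      using card_le_Suc0_iff_eq[of "scc_of ` verts G"] by auto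
    have "v \<notin> scc_of u" using uv scc_of_eq by blast
    moreover have "u \<in> scc_of u" using uv in_scc_of_self by blast
    moreover have "scc_of u \<subseteq> verts G" by (auto simp: scc_of_def reachable_in_verts)
    moreover have "(a, b) \<notin> arcs_ends G" if "a \<in> scc_of u" "b \<in> verts G - scc_of u" for a b
    proof
      assume "(a, b) \<in> arcs_ends G"
      then have "a \<rightarrow>\<^sup>* b" by blast
      then have "b \<in> scc_of a" by (rule scc_ofI_reachable')
      then show False using that scc_of_eq by blast
    qed
    ultimately show "\<exists>A B. A \<noteq> {} \<and> B \<noteq> {} \<and> A \<inter> B = {} \<and> A \<union> B = verts G \<and>
        (\<forall>a\<in>A. \<forall>b\<in>B. (a, b) \<notin> arcs_ends G)"
      using uv by (intro exI[of _ "scc_of u"] exI[of _ "verts G - scc_of u"] conjI ballI) auto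
  next
    assume "\<exists>A B. A \<noteq> {} \<and> B \<noteq> {} \<and> A \<inter> B = {} \<and> A \<union> B = verts G \<and>
        (\<forall>a\<in>A. \<forall>b\<in>B. (a, b) \<notin> arcs_ends G)"
    then obtain A B where ne: "A \<noteq> {}" "B \<noteq> {}" and AB': "A \<inter> B = {}" "A \<union> B = verts G"
        "\<forall>a\<in>A. \<forall>b\<in>B. (a, b) \<notin> arcs_ends G" by (elim exE conjE)
    obtain a b where "a \<in> A" "b \<in> B" using ne by blast
    note AB = this AB'
    have closed: "w \<in> A" if "a \<rightarrow>\<^sup>* w" for w
      using that
    proof (induction rule: reachable_induct)
      case (step x y)
      then have "y \<in> verts G" by (auto dest: adj_in_verts)
      then show ?case using step AB by blast
    qed (use AB in simp)
    have "b \<in> scc_of b" using AB in_scc_of_self by blast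
    moreover have "b \<notin> scc_of a" using closed[of b] AB(2,3) by (auto simp: scc_of_def)
    ultimately have "scc_of a \<noteq> scc_of b" by blast
    then have "card {scc_of a, scc_of b} = 2" by simp
    moreover have "{scc_of a, scc_of b} \<subseteq> scc_of ` verts G" using AB by blast
    ultimately show "disconnected_graph G"
      using card card_mono[of "scc_of ` verts G" "{scc_of a, scc_of b}"] by simp
  qed
qed

lemma has_stable_cutset_iff_has_cut:
  assumes "pair_graph G"
  shows "has_stable_cutset (with_proj G) \<longleftrightarrow> has_cut (pverts G) (\<lambda>u v. (u, v) \<in> parcs G)"
proof -
  interpret pair_graph G by fact
  have disc: "disconnected_graph (delete_verts (with_proj G) S) \<longleftrightarrow>
     (\<exists>A B. A \<noteq> {} \<and> B \<noteq> {} \<and> A \<inter> B = {} \<and> A \<union> B = pverts G - S \<and> (\<forall>a\<in>A. \<forall>b\<in>B. (a, b) \<notin> parcs G))" for S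
  proof -
    interpret H: graph "with_proj G \<restriction> (pverts G - S)"
      using graph_induce[of "pverts G - S"] by simp
    have ends: "(a, b) \<in> arcs_ends (with_proj G \<restriction> (pverts G - S)) \<longleftrightarrow>
        (a, b) \<in> parcs G \<and> a \<in> pverts G - S \<and> b \<in> pverts G - S" for a b
      by (auto simp: arcs_ends_induce arcs_ends_conv)
    show ?thesis
      unfolding delete_verts_def with_proj_simps induce_subgraph_verts ends H.disconnected_graph_iff
      by (intro iff_exI conj_cong refl ball_cong) blast
  qed
  show ?thesis
  proof
    assume "has_stable_cutset (with_proj G)"
    then obtain S A B where "S \<subseteq> pverts G" "\<forall>u\<in>S. \<forall>v\<in>S. (u, v) \<notin> parcs G"
      "A \<noteq> {}" "B \<noteq> {}" "A \<inter> B = {}" "A \<union> B = pverts G - S" "\<forall>a\<in>A. \<forall>b\<in>B. (a, b) \<notin> parcs G"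
      unfolding has_stable_cutset_def stable_cutset_def disc by (auto simp: arcs_ends_conv)
    then show "has_cut (pverts G) (\<lambda>u v. (u, v) \<in> parcs G)"
      by (intro has_cutI[of A _ B]) blast+
  next
    assume "has_cut (pverts G) (\<lambda>u v. (u, v) \<in> parcs G)"
    then obtain A B where AB: "A \<subseteq> pverts G" "B \<subseteq> pverts G" "A \<noteq> {}" "B \<noteq> {}" "A \<inter> B = {}"
      "\<forall>a\<in>A. \<forall>b\<in>B. (a, b) \<notin> parcs G"
      "\<forall>u\<in>pverts G - (A \<union> B). \<forall>v\<in>pverts G - (A \<union> B). (u, v) \<notin> parcs G"
      unfolding has_cut_def by blast
    have "A \<union> B = pverts G - (pverts G - (A \<union> B))" using AB(1,2) by blast
    then have "disconnected_graph (delete_verts (with_proj G) (pverts G - (A \<union> B)))"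
      unfolding disc using AB(3-6) by blast
    then show "has_stable_cutset (with_proj G)"
      unfolding has_stable_cutset_def stable_cutset_def using AB(7)
      by (intro exI[of _ "pverts G - (A \<union> B)"]) (auto simp: arcs_ends_conv)
  qed
qed

text \<open>Cluster graphs are the graphs without an induced path on three vertices: the condition
  collapses reachability to equality or adjacency.\<close>

lemma (in graph) cluster_graph_iff:
  "cluster_graph G \<longleftrightarrow> (\<forall>u v w. (u, v) \<in> arcs_ends G \<longrightarrow> (v, w) \<in> arcs_ends G \<longrightarrow> u \<noteq> w \<longrightarrow> (u, w) \<in> arcs_ends G)"
proof
  assume cl: "cluster_graph G"
  show "\<forall>u v w. (u, v) \<in> arcs_ends G \<longrightarrow> (v, w) \<in> arcs_ends G \<longrightarrow> u \<noteq> w \<longrightarrow> (u, w) \<in> arcs_ends G"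
  proof (intro allI impI)
    fix u v w assume uvw: "(u, v) \<in> arcs_ends G" "(v, w) \<in> arcs_ends G" "u \<noteq> w"
    then have "u \<rightarrow>\<^sup>* v" "v \<rightarrow>\<^sup>* w" by blast+
    then have uw: "u \<rightarrow>\<^sup>* w" by (rule reachable_trans)
    then have u: "u \<in> verts G" by (simp add: reachable_in_verts)
    let ?H = "G \<restriction> {v. u \<rightarrow>\<^sup>* v}"
    have "?H \<in> sccs" using u by (rule induce_reachable_is_in_sccs)
    then have "complete_digraph (card (verts ?H)) ?H" using cl unfolding cluster_graph_def by blast
    moreover have "u \<in> verts ?H" "w \<in> verts ?H" using u uw by auto
    ultimately have "(u, w) \<in> arcs_ends ?H" using uvw(3) unfolding complete_digraph_def by simp
    then show "(u, w) \<in> arcs_ends G" by (simp add: arcs_ends_induce)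
  qed
next
  assume tr: "\<forall>u v w. (u, v) \<in> arcs_ends G \<longrightarrow> (v, w) \<in> arcs_ends G \<longrightarrow> u \<noteq> w \<longrightarrow> (u, w) \<in> arcs_ends G"
  have reach: "u = v \<or> (u, v) \<in> arcs_ends G" if "u \<rightarrow>\<^sup>* v" for u v
    using that by (induction rule: reachable_induct) (use tr in auto)
  have "complete_digraph (card (verts H)) H" if H: "H \<in> sccs" for H
  proof -
    obtain S where S: "S \<in> sccs_verts" "H = G \<restriction> S"
      using H unfolding sccs_conv_sccs_verts by blast
    then have sub: "S \<subseteq> verts G" using sccs_verts_subsets by blast
    have "(u, v) \<in> arcs_ends G" if "u \<in> S" "v \<in> S" "u \<noteq> v" for u v
    proof -
      have "u \<rightarrow>\<^sup>* v" using S that unfolding in_sccs_verts_conv_reachable by blast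
      then show ?thesis using reach that by blast
    qed
    moreover have "u \<noteq> v" if "(u, v) \<in> arcs_ends G" for u v
      using that no_loops by (auto simp: arcs_ends_conv)
    ultimately have "arcs_ends H = {(u, v). (u, v) \<in> verts H \<times> verts H \<and> u \<noteq> v}"
      unfolding S(2) arcs_ends_induce by auto
    moreover have "graph H" using graph_induce[OF sub] S by simp
    ultimately show ?thesis unfolding complete_digraph_def by blast
  qed
  then show "cluster_graph G" unfolding cluster_graph_def using graph_axioms by blast
qed

lemma mod_cluster_instance_iff:
  "mod_cluster_instance G X \<longleftrightarrow> pair_graph G \<and> X \<subseteq> pverts G \<and>
     (\<forall>u v w. u \<notin> X \<longrightarrow> v \<notin> X \<longrightarrow> w \<notin> X \<longrightarrow> (u, v) \<in> parcs G \<longrightarrow> (v, w) \<in> parcs G \<longrightarrow> u \<noteq> w \<longrightarrow> (u, w) \<in> parcs G)"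
proof (cases "pair_graph G")
  case True
  then interpret pair_graph G .
  interpret H: graph "with_proj G \<restriction> (pverts G - X)"
    using graph_induce[of "pverts G - X"] by simp
  let ?H = "with_proj G \<restriction> (pverts G - X)"
  have ends: "(u, v) \<in> arcs_ends ?H \<longleftrightarrow> (u, v) \<in> parcs G \<and> u \<notin> X \<and> v \<notin> X" for u v
    using in_arcsD1 in_arcsD2 by (auto simp: arcs_ends_induce arcs_ends_conv)
  have "cluster_graph ?H \<longleftrightarrow> (\<forall>u v w. u \<notin> X \<longrightarrow> v \<notin> X \<longrightarrow> w \<notin> X \<longrightarrow>
      (u, v) \<in> parcs G \<longrightarrow> (v, w) \<in> parcs G \<longrightarrow> u \<noteq> w \<longrightarrow> (u, w) \<in> parcs G)"
    unfolding H.cluster_graph_iff ends by blast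
  then show ?thesis
    unfolding mod_cluster_instance_def delete_verts_def using True by simp
qed (simp add: mod_cluster_instance_def)

section \<open>The kernelization program\<close>

text \<open>In programs, the \<open>i\<close>-th vertex of the encoded graph is represented by the unary numeral \<open>num_d i\<close>.\<close>

definition verts_d :: "data \<Rightarrow> data list" where
  "verts_d x = map num_d [0..<length (dlist x)]"

definition inX_d :: "data \<Rightarrow> data \<Rightarrow> bool" where
  "inX_d x v \<longleftrightarrow> hd_d (nth_d x v) \<noteq> Nil_d"

definition adj_d :: "data \<Rightarrow> data \<Rightarrow> data \<Rightarrow> bool" where
  "adj_d x u v \<longleftrightarrow> nth_d (tl_d (nth_d x u)) v \<noteq> Nil_d"

text \<open>Follows the layout of \<open>encode_instance\<close>. As encodings do not record vertex
  names, the result can be an encoding of an induced subgraph of the original graph.\<close>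

definition subinstance_d :: "data \<Rightarrow> data list \<Rightarrow> data" where
  "subinstance_d x ws =
     list_d (map (\<lambda>v. Cons_d (bool_d (inX_d x v)) (list_d (map (\<lambda>w. bool_d (adj_d x v w)) ws))) ws)"

text \<open>The constant yes-instance is two isolated vertices, separated by the empty cutset; the
  constant no-instance is the null graph. Both enter the program as fixed trees.\<close>

definition kernelize :: "data \<Rightarrow> data" where
  "kernelize x =
     (if easy_yes (inX_d x) (adj_d x) (verts_d x)
      then encode_instance \<lparr>pverts = {0, 1}, parcs = {}\<rparr> {}
      else if easy_no (inX_d x) (adj_d x) (verts_d x)
      then encode_instance \<lparr>pverts = {}, parcs = {}\<rparr> {}
      else subinstance_d x (kernel (inX_d x) (adj_d x) (verts_d x)))"

section \<open>Polynomial running time of the kernelization\<close>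

lemma polytime_verts_d: "polytime g \<Longrightarrow> polytime (\<lambda>x. list_d (verts_d (g x)))"
  unfolding verts_d_def by (intro polytime_list_numerals polytime_dlist)

lemma polytime_inX_d: "polytime g \<Longrightarrow> polytime u \<Longrightarrow> polytime (\<lambda>x. bool_d (inX_d (g x) (u x)))"
  unfolding inX_d_def by (intro polytime_intros)

lemma polytime_adj_d:
  "polytime g \<Longrightarrow> polytime u \<Longrightarrow> polytime v \<Longrightarrow> polytime (\<lambda>x. bool_d (adj_d (g x) (u x) (v x)))"
  unfolding adj_d_def by (intro polytime_intros)

lemmas polytime_graph_intros =
  polytime_intros polytime_verts_d polytime_inX_d polytime_adj_d

lemma polytime_clique_of:
  assumes "polytime g" "polytime u"
  shows "polytime (\<lambda>x. list_d (clique_of (inX_d (g x)) (adj_d (g x)) (verts_d (g x)) (u x)))"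
  unfolding clique_of_def
  \<comment> \<open>Under the binder of the filter the input has become \<open>tl_d z\<close>, so
    \<open>g\<close> and \<open>u\<close> occur composed with a projection;
    \<open>polytime_comp\<close> covers these occurrences.\<close>
  by (intro polytime_graph_intros assms(1)[THEN polytime_comp] assms(2)[THEN polytime_comp])

lemma polytime_nbrs:
  assumes "polytime g" "polytime (\<lambda>x. list_d (D x))"
  shows "polytime (\<lambda>x. list_d (nbrs (adj_d (g x)) (verts_d (g x)) (D x)))"
  unfolding nbrs_def
  by (intro polytime_graph_intros assms(1)[THEN polytime_comp] assms(2)[THEN polytime_comp])

lemma polytime_stable_nbrs:
  assumes "polytime g" "polytime (\<lambda>x. list_d (D x))"
  shows "polytime (\<lambda>x. bool_d (stable_nbrs (adj_d (g x)) (verts_d (g x)) (D x)))"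
  unfolding stable_nbrs_def
  by (intro polytime_graph_intros polytime_nbrs assms(1)[THEN polytime_comp] assms(2)[THEN polytime_comp])

lemma polytime_separating_nbrs:
  assumes "polytime g" "polytime (\<lambda>x. list_d (D x))"
  shows "polytime (\<lambda>x. bool_d (separating_nbrs (adj_d (g x)) (verts_d (g x)) (D x)))"
  unfolding separating_nbrs_def
  by (intro polytime_graph_intros polytime_stable_nbrs polytime_nbrs
      assms(1)[THEN polytime_comp] assms(2)[THEN polytime_comp])

lemma polytime_easy_yes:
  "polytime (\<lambda>x. bool_d (easy_yes (inX_d x) (adj_d x) (verts_d x)))"
  unfolding easy_yes_def
  by (intro polytime_graph_intros polytime_separating_nbrs polytime_clique_of)

lemma polytime_easy_no:
  "polytime (\<lambda>x. bool_d (easy_no (inX_d x) (adj_d x) (verts_d x)))"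
  unfolding easy_no_def
  by (intro polytime_graph_intros polytime_stable_nbrs polytime_clique_of)

lemma polytime_attached:
  assumes "polytime g" "polytime (\<lambda>x. list_d (L x))" "polytime b" "polytime c"
  shows "polytime (\<lambda>x. bool_d (attached (adj_d (g x)) (L x) e (b x) (c x)))"
  unfolding attached_def
  by (intro polytime_graph_intros assms[THEN polytime_comp])

lemma polytime_reduced_clique:
  assumes "polytime g" "polytime (\<lambda>x. list_d (L x))" "polytime b" "polytime c" "polytime a" "polytime d"
  shows "polytime (\<lambda>x. list_d (reduced_clique (inX_d (g x)) (adj_d (g x)) (verts_d (g x)) (L x) (b x) (c x) (a x) (d x)))"
  unfolding reduced_clique_def
  by (intro polytime_graph_intros assms[THEN polytime_comp])

lemma polytime_marked:
  assumes "polytime g"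
  shows "polytime (\<lambda>x. list_d (marked (inX_d (g x)) (adj_d (g x)) (verts_d (g x)) e e'))"
  unfolding marked_def
  by (intro polytime_graph_intros polytime_attached polytime_reduced_clique polytime_clique_of
      assms[THEN polytime_comp])

lemma polytime_kernel:
  "polytime (\<lambda>x. list_d (kernel (inX_d x) (adj_d x) (verts_d x)))"
  unfolding kernel_def by (intro polytime_graph_intros polytime_marked)

lemma polytime_subinstance_d:
  assumes "polytime (\<lambda>x. list_d (ws x))"
  shows "polytime (\<lambda>x. subinstance_d x (ws x))"
  unfolding subinstance_d_def by (intro polytime_graph_intros assms[THEN polytime_comp])

lemma polytime_kernelize: "polytime kernelize"
  unfolding kernelize_def
  by (intro polytime_if polytime_const polytime_easy_yes polytime_easy_no polytime_subinstance_d polytime_kernel)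

section \<open>Correctness on encodings\<close>

definition vertex_of :: "nat list \<Rightarrow> data \<Rightarrow> nat" where
  "vertex_of vs v = vs ! length (dlist v)"

lemma vertex_of_num_d [simp]: "vertex_of vs (num_d i) = vs ! i"
  by (simp add: vertex_of_def num_d_def)

definition induced_pair :: "'a pair_pre_digraph \<Rightarrow> 'a set \<Rightarrow> 'a pair_pre_digraph" where
  "induced_pair G S = \<lparr>pverts = S, parcs = parcs G \<inter> S \<times> S\<rparr>"

lemma pair_graph_induced_pair:
  assumes "pair_graph G" "S \<subseteq> pverts G"
  shows "pair_graph (induced_pair G S)"
proof -
  interpret pair_graph G by fact
  have "symmetric (with_proj (induced_pair G S))"
    using sym_arcs by (auto simp: induced_pair_def symmetric_def arcs_ends_conv sym_def)
  then show ?thesis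
    using assms(2) finite_subset[OF assms(2)] pair_no_loops
    by unfold_locales (auto simp: induced_pair_def)
qed

lemma mod_cluster_instance_induced_pair:
  assumes "mod_cluster_instance G X" "X \<subseteq> S" "S \<subseteq> pverts G"
  shows "mod_cluster_instance (induced_pair G S) X"
proof -
  have "pair_graph (induced_pair G S)"
    using assms pair_graph_induced_pair mod_cluster_instance_iff by blast
  have tr: "(u, w) \<in> parcs G" if "u \<notin> X" "v \<notin> X" "w \<notin> X" "(u, v) \<in> parcs G" "(v, w) \<in> parcs G" "u \<noteq> w"
    for u v w
    using assms(1) that unfolding mod_cluster_instance_iff by blast
  show ?thesis
    unfolding mod_cluster_instance_iff
  proof (intro conjI allI impI)
    show "pair_graph (induced_pair G S)" by fact
    show "X \<subseteq> pverts (induced_pair G S)" using assms(2) by (simp add: induced_pair_def)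
    show "(u, w) \<in> parcs (induced_pair G S)" if "u \<notin> X" "v \<notin> X" "w \<notin> X"
      "(u, v) \<in> parcs (induced_pair G S)" "(v, w) \<in> parcs (induced_pair G S)" "u \<noteq> w" for u v w
      using that(4,5) tr[OF that(1-3) _ _ that(6)] by (simp add: induced_pair_def)
  qed
qed

locale encoded_instance =
  fixes G :: "nat pair_pre_digraph" and X :: "nat set"
  assumes inst: "mod_cluster_instance G X"
begin

abbreviation "vs \<equiv> sorted_list_of_set (pverts G)"
abbreviation "x \<equiv> encode_instance G X"

sublocale pair_graph G
  using inst by (simp add: mod_cluster_instance_iff)

lemma verts_d_encode: "verts_d x = map num_d [0..<length vs]"
  by (simp add: verts_d_def encode_instance_def Let_def)

lemma in_verts_d: "v \<in> set (verts_d x) \<longleftrightarrow> (\<exists>i<length vs. v = num_d i)"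
  by (auto simp: verts_d_encode)

lemma inX_d_encode: "i < length vs \<Longrightarrow> inX_d x (num_d i) \<longleftrightarrow> vs ! i \<in> X"
  by (simp add: inX_d_def encode_instance_def Let_def nth_d_list_d)

lemma adj_d_encode:
  "i < length vs \<Longrightarrow> j < length vs \<Longrightarrow> adj_d x (num_d i) (num_d j) \<longleftrightarrow> (vs ! i, vs ! j) \<in> parcs G"
  by (simp add: adj_d_def encode_instance_def Let_def nth_d_list_d)

lemma inX_d_iff: "v \<in> set (verts_d x) \<Longrightarrow> inX_d x v \<longleftrightarrow> vertex_of vs v \<in> X"
  by (auto simp: in_verts_d inX_d_encode)

lemma adj_d_iff:
  "u \<in> set (verts_d x) \<Longrightarrow> v \<in> set (verts_d x) \<Longrightarrow> adj_d x u v \<longleftrightarrow> (vertex_of vs u, vertex_of vs v) \<in> parcs G"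
  by (auto simp: in_verts_d adj_d_encode)

lemma inj_on_vertex_of: "inj_on (vertex_of vs) (set (verts_d x))"
  by (auto simp: inj_on_def in_verts_d nth_eq_iff_index_eq)

lemma image_vertex_of: "vertex_of vs ` set (verts_d x) = pverts G"
proof -
  have "vertex_of vs ` set (verts_d x) = set vs"
    unfolding verts_d_encode set_map image_image vertex_of_num_d set_upt
    using nth_image[of "length vs" vs] by simp
  then show ?thesis by simp
qed

sublocale mod_cluster "inX_d x" "adj_d x" "verts_d x"
proof
  show "distinct (verts_d x)"
    by (simp add: verts_d_encode distinct_map inj_on_def)
  show "adj_d x v u" if "u \<in> set (verts_d x)" "v \<in> set (verts_d x)" "adj_d x u v" for u v
    using that arcs_symmetric by (simp add: adj_d_iff)
  show "\<not> adj_d x u u" if "u \<in> set (verts_d x)" for u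
    using that pair_no_loops by (force simp: adj_d_iff)
  show "adj_d x u w" if uvw: "u \<in> set (verts_d x)" "v \<in> set (verts_d x)" "w \<in> set (verts_d x)"
    "\<not> inX_d x u" "\<not> inX_d x v" "\<not> inX_d x w" "adj_d x u v" "adj_d x v w" "u \<noteq> w" for u v w
  proof -
    have "vertex_of vs u \<noteq> vertex_of vs w"
      using uvw inj_on_vertex_of by (auto dest: inj_onD)
    moreover have "(a, c) \<in> parcs G"
      if "a \<notin> X" "b \<notin> X" "c \<notin> X" "(a, b) \<in> parcs G" "(b, c) \<in> parcs G" "a \<noteq> c" for a b c
      using inst that unfolding mod_cluster_instance_iff by blast
    from this[of "vertex_of vs u" "vertex_of vs v" "vertex_of vs w"] calculation show ?thesis
      using uvw by (simp add: adj_d_iff inX_d_iff)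
  qed
qed

lemma has_cut_image_vertex_of:
  assumes "U \<subseteq> set (verts_d x)"
  shows "has_cut (vertex_of vs ` U) (\<lambda>u v. (u, v) \<in> parcs (induced_pair G (vertex_of vs ` U))) \<longleftrightarrow> has_cut U (adj_d x)"
proof (rule has_cut_image_iff)
  show "inj_on (vertex_of vs) U"
    using inj_on_vertex_of assms by (rule inj_on_subset)
  show "(vertex_of vs u, vertex_of vs v) \<in> parcs (induced_pair G (vertex_of vs ` U)) \<longleftrightarrow> adj_d x u v"
    if "u \<in> U" "v \<in> U" for u v
    using that assms adj_d_iff[of u v] by (auto simp: induced_pair_def)
qed

lemma has_stable_cutset_iff: "has_stable_cutset (with_proj G) \<longleftrightarrow> has_cut (set (verts_d x)) (adj_d x)"
proof -
  have "parcs (induced_pair G (pverts G)) = parcs G"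
    using in_arcsD1 in_arcsD2 by (auto simp: induced_pair_def)
  then show ?thesis
    using has_cut_image_vertex_of[of "set (verts_d x)"] has_stable_cutset_iff_has_cut[OF pair_graph]
    by (simp add: image_vertex_of)
qed

text \<open>\<open>encode_instance\<close> lists vertices in increasing order. A filter of
  \<open>verts_d\<close> keeps positions increasing in the sorted list \<open>vs\<close>, so it
  already enumerates \<open>S\<close> in the order required for rows and columns.\<close>

lemma encode_induced_pair:
  fixes P
  defines "ws \<equiv> filter P (verts_d x)"
  defines "S \<equiv> vertex_of vs ` set ws"
  assumes "X \<subseteq> S"
  shows "encode_instance (induced_pair G S) X = subinstance_d x ws"
proof -
  have sub: "set ws \<subseteq> set (verts_d x)" by (auto simp: ws_def)
  have ws: "ws = map num_d (filter (\<lambda>i. P (num_d i)) [0..<length vs])"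
    by (simp add: ws_def verts_d_encode filter_map comp_def)
  have "sorted_wrt (<) vs" by simp
  then have nth_mono: "vs ! i < vs ! j" if "i < j" "j < length vs" for i j
    using that by (rule sorted_wrt_nth_less)
  have "sorted_wrt (<) (filter (\<lambda>i. P (num_d i)) [0..<length vs])"
    by (rule sorted_wrt_filter) simp
  then have "sorted_wrt (\<lambda>i j. vs ! i < vs ! j) (filter (\<lambda>i. P (num_d i)) [0..<length vs])"
    by (rule sorted_wrt_mono_rel[rotated]) (auto intro: nth_mono)
  then have "sorted_wrt (<) (map (vertex_of vs) ws)"
    by (simp add: ws sorted_wrt_map)
  then have "sorted_list_of_set S = map (vertex_of vs) ws"
    unfolding S_def by (metis set_map sorted_list_of_set.idem_if_sorted_distinct strict_sorted_iff)
  then show ?thesis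
    using sub unfolding encode_instance_def[of "induced_pair G S"] subinstance_d_def Let_def
    by (auto simp: induced_pair_def S_def inX_d_iff adj_d_iff subset_iff
        intro!: arg_cong[where f = list_d] arg_cong[where f = bool_d])
qed

lemma kernelize_correct:
  "\<exists>G' X'. kernelize x = encode_instance G' X' \<and> mod_cluster_instance G' X' \<and>
     (has_stable_cutset (with_proj G') \<longleftrightarrow> has_stable_cutset (with_proj G)) \<and>
     card (pverts G') \<le> 17 * max 1 (card X) ^ 5"
proof -
  let ?yes = "easy_yes (inX_d x) (adj_d x) (verts_d x)" and ?no = "easy_no (inX_d x) (adj_d x) (verts_d x)"
  \<comment> \<open>Because of \<open>max 1\<close>, there is room for the two-vertex yes-instance
    even if \<open>X\<close> is empty.\<close>
  have pos: "2 \<le> 17 * max 1 (card X) ^ 5"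
    using one_le_power[of "max 1 (card X)" 5] by linarith
  consider "?yes" | "\<not> ?yes" "?no" | "\<not> ?yes" "\<not> ?no" by blast
  then show ?thesis
  proof cases
    case 1
    let ?G = "\<lparr>pverts = {0, 1}, parcs = {}\<rparr> :: nat pair_pre_digraph"
    have G: "pair_graph ?G"
      by unfold_locales (auto simp: symmetric_def arcs_ends_conv sym_def)
    have "has_cut {0, 1 :: nat} (\<lambda>u v. (u, v) \<in> parcs ?G)"
      by (rule has_cutI[of "{0}" _ "{1}"]) auto
    then have "has_stable_cutset (with_proj ?G)"
      using has_stable_cutset_iff_has_cut[OF G] by simp
    moreover have "has_stable_cutset (with_proj G)"
      using has_cut_easy_yes[OF 1] has_stable_cutset_iff by simp
    moreover have "mod_cluster_instance ?G {}"
      unfolding mod_cluster_instance_iff using G by simp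
    moreover have "card (pverts ?G) \<le> 17 * max 1 (card X) ^ 5"
    proof -
      have "card (pverts ?G) = 2" by simp
      then show ?thesis using pos by (simp only:)
    qed
    ultimately show ?thesis
      using 1 by (intro exI[of _ ?G] exI[of _ "{}"]) (simp add: kernelize_def)
  next
    case 2
    let ?G = "\<lparr>pverts = {}, parcs = {}\<rparr> :: nat pair_pre_digraph"
    have G: "pair_graph ?G"
      by unfold_locales (auto simp: symmetric_def arcs_ends_conv sym_def)
    have "\<not> has_stable_cutset (with_proj ?G)"
      using has_stable_cutset_iff_has_cut[OF G] by (simp add: has_cut_def)
    moreover have "\<not> has_stable_cutset (with_proj G)"
      using no_cut_easy_no[OF 2] has_stable_cutset_iff by simp
    moreover have "mod_cluster_instance ?G {}"
      unfolding mod_cluster_instance_iff using G by simp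
    ultimately show ?thesis
      using 2 by (intro exI[of _ ?G] exI[of _ "{}"]) (simp add: kernelize_def)
  next
    case 3
    define ws where "ws = kernel (inX_d x) (adj_d x) (verts_d x)"
    define S where "S = vertex_of vs ` set ws"
    have sub: "set ws \<subseteq> set (verts_d x)" using in_W by (auto simp: ws_def)
    then have "S \<subseteq> vertex_of vs ` set (verts_d x)" unfolding S_def by (rule image_mono)
    then have S_sub: "S \<subseteq> pverts G" by (simp only: image_vertex_of)
    have X: "X = vertex_of vs ` (set (verts_d x) \<inter> Collect (inX_d x))"
    proof
      show "X \<subseteq> vertex_of vs ` (set (verts_d x) \<inter> Collect (inX_d x))"
      proof
        fix v assume v: "v \<in> X"
        then have "v \<in> pverts G" using inst by (auto simp: mod_cluster_instance_iff)
        then obtain u where "u \<in> set (verts_d x)" "v = vertex_of vs u"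
          using image_vertex_of by blast
        then show "v \<in> vertex_of vs ` (set (verts_d x) \<inter> Collect (inX_d x))"
          using v inX_d_iff by blast
      qed
    qed (use inX_d_iff in blast)
    have "set (verts_d x) \<inter> Collect (inX_d x) \<subseteq> set ws" using in_W by (auto simp: ws_def)
    then have "vertex_of vs ` (set (verts_d x) \<inter> Collect (inX_d x)) \<subseteq> S"
      unfolding S_def by (rule image_mono)
    then have X_S: "X \<subseteq> S" by (simp only: X[symmetric])
    obtain P where P: "ws = filter P (verts_d x)" by (simp add: ws_def kernel_def)
    have "encode_instance (induced_pair G S) X = subinstance_d x ws"
      using encode_induced_pair[of P] X_S unfolding S_def P by simp
    then have "kernelize x = encode_instance (induced_pair G S) X"
      using 3 by (simp add: kernelize_def ws_def)
    moreover have inst': "mod_cluster_instance (induced_pair G S) X"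
      using inst X_S S_sub by (rule mod_cluster_instance_induced_pair)
    moreover have "has_cut (set ws) (adj_d x) \<longleftrightarrow> has_cut (set (verts_d x)) (adj_d x)"
      using has_cut_kernel[OF 3(2)] has_cut_of_kernel[OF 3(2)] unfolding ws_def by blast
    then have "has_stable_cutset (with_proj (induced_pair G S)) \<longleftrightarrow> has_stable_cutset (with_proj G)"
      using has_stable_cutset_iff_has_cut[of "induced_pair G S"] inst' has_stable_cutset_iff
        has_cut_image_vertex_of[OF sub]
      by (simp add: mod_cluster_instance_iff S_def) (simp add: induced_pair_def)
    moreover have "card (vertex_of vs ` (set (verts_d x) \<inter> Collect (inX_d x))) =
        card (set (verts_d x) \<inter> Collect (inX_d x))"
      by (rule card_image) (auto intro: inj_on_subset[OF inj_on_vertex_of])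
    then have "card X = card (set (verts_d x) \<inter> Collect (inX_d x))"
      by (simp only: X[symmetric])
    then have "length ws \<le> 17 * max 1 (card X) ^ 5"
      using length_kernel by (simp add: ws_def)
    then have "card (pverts (induced_pair G S)) \<le> 17 * max 1 (card X) ^ 5"
      using card_image_le[of "set ws" "vertex_of vs"] card_length[of ws]
      by (simp add: induced_pair_def S_def)
    ultimately show ?thesis by blast
  qed
qed

end

theorem theorem5:
  shows "\<exists>(P :: com) (p :: nat poly) (c :: nat).
    \<forall>(G :: nat pair_pre_digraph) (X :: nat set). mod_cluster_instance G X \<longrightarrow>
      (\<exists>(G' :: nat pair_pre_digraph) (X' :: nat set) (t :: nat).
          computes P (encode_instance G X) (encode_instance G' X') t
        \<and> t \<le> poly p (dsize (encode_instance G X))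
        \<and> mod_cluster_instance G' X'
        \<and> (has_stable_cutset (with_proj G') \<longleftrightarrow> has_stable_cutset (with_proj G))
        \<and> card (pverts G') \<le> c * max 1 (card X) ^ 5)"
proof -
  obtain C p where C: "runs_in C kernelize p"
    using polytime_kernelize by (rule polytimeE)
  \<comment> \<open>\<open>computes\<close> reads and writes register 0, so the member
    \<open>C 0\<close> of the family is the required program.\<close>
  have run: "\<exists>t. computes (C 0) x (kernelize x) t \<and> t \<le> poly p (dsize x)" for x
    using runs_inD[OF C, of 0 "(\<lambda>_. Nil_d)(0 := x)"] unfolding computes_def by fastforce
  show ?thesis
  proof (intro exI[of _ "C 0"] exI[of _ p] exI[of _ 17] allI impI)
    fix G :: "nat pair_pre_digraph" and X :: "nat set"
    assume "mod_cluster_instance G X"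
    then interpret encoded_instance G X by unfold_locales
    from kernelize_correct obtain G' X' where G': "kernelize (encode_instance G X) = encode_instance G' X'"
      "mod_cluster_instance G' X'" "has_stable_cutset (with_proj G') \<longleftrightarrow> has_stable_cutset (with_proj G)"
      "card (pverts G') \<le> 17 * max 1 (card X) ^ 5"
      by (elim exE conjE)
    obtain t where "computes (C 0) (encode_instance G X) (kernelize (encode_instance G X)) t"
      "t \<le> poly p (dsize (encode_instance G X))"
      using run by blast
    with G' show "\<exists>G' X' t. computes (C 0) (encode_instance G X) (encode_instance G' X') t
        \<and> t \<le> poly p (dsize (encode_instance G X))
        \<and> mod_cluster_instance G' X'
        \<and> (has_stable_cutset (with_proj G') \<longleftrightarrow> has_stable_cutset (with_proj G))
        \<and> card (pverts G') \<le> 17 * max 1 (card X) ^ 5"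
      by (intro exI[of _ G'] exI[of _ X'] exI[of _ t]) simp
  qed
qed

end
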